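(* Let $C$ be a completely regular code of strength $1$ in $J(n,4)$ with $\theta_4(n,4)\in Spec(C)$. Then $C$ has covering radius $2$, $Spec(C)=\{\theta_0(n,4),\theta_2(n,4),\theta_4(n,4)\}$, and $C$ is of type (GP.3') or of type (M.1) for $w=4$.
   Context: The Johnson graph $J(n,w)$ has as vertices the $w$-subsets of $\{1,\dots,n\}$, adjacent iff they meet in a $(w-1)$-subset; $w\le n/2$ is assumed. Its eigenvalues are $\theta_i(n,w)=(n-w-i)(w-i)-i$, $i=0,\dots,w$. For a code $C$, $C_i$ is the set of vertices at distance exactly $i$ from $C$ and the covering radius $\rho$ is the largest $i$ with $C_i\ne\emptyset$; $C$ is completely regular if there are numbers $\alpha_i,\beta_i,\gamma_i$ such that each vertex of $C_i$ has exactly $\alpha_i,\beta_i,\gamma_i$ neighbours in $C_i,C_{i+1},C_{i-1}$; $Spec(C)$ is the set of eigenvalues of the tridiagonal intersection matrix with diagonal $\alpha_0,\dots,\alpha_\rho$, superdiagonal $\beta_0,\dots,\beta_{\rho-1}$, subdiagonal $\gamma_1,\dots,\gamma_\rho$. The strength of $C$ is the largest $t$ such that every $t$-subset of $\{1,\dots,n\}$ lies in the same number of members of $C$. (GP.3'): for a partition $Y_1,Y_2$ of $\{1,\dots,n\}$ into two parts of size $n/2$, $C=\{x: |x|=4,\ \exists i,\ x\subseteq Y_i\}$. (M.1) for $w=4$: $n$ even, $Y_i=\{2i-1,2i\}$ for $i=1,\dots,n/2$, $C=\{Y_i\cup Y_j: i\neq j\}$ (codes being considered up to a permutation of $\{1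,\dots,n\}$).
   Formalization: "C is of type (GP.3') or of type (M.1)" is stated as: C or its farthest layer C_ρ is of one of these types; as worded the claim fails, e.g. for n=8 and C={x: |x∩Y_1|=2} with Y_1 a half of {1,...,8}. *)

theory Defs
  imports
    "Jordan_Normal_Form.Spectral_Radius"
    "HOL-Combinatorics.Permutations"
begin

definition johnson_verts :: "nat \<Rightarrow> nat \<Rightarrow> nat set set" where
  "johnson_verts n w = {x. x \<subseteq> {1..n} \<and> card x = w}"

(* "Suc ... = w" instead of "... = w - 1" keeps the relation irreflexive also for w = 0. *)
definition johnson_edges :: "nat \<Rightarrow> nat \<Rightarrow> (nat set \<times> nat set) set" where
  "johnson_edges n w =
     {(x, y). x \<in> johnson_verts n w \<and> y \<in> johnson_verts n w \<and> Suc (card (x \<inter> y)) = w}"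

definition johnson_dist :: "nat \<Rightarrow> nat \<Rightarrow> nat set \<Rightarrow> nat set \<Rightarrow> nat" where
  "johnson_dist n w x y = (LEAST k. (x, y) \<in> johnson_edges n w ^^ k)"

definition johnson_eigenvalue :: "nat \<Rightarrow> nat \<Rightarrow> nat \<Rightarrow> complex" where
  "johnson_eigenvalue n w i =
     (of_nat n - of_nat w - of_nat i) * (of_nat w - of_nat i) - of_nat i"

definition is_code :: "nat \<Rightarrow> nat \<Rightarrow> nat set set \<Rightarrow> bool" where
  "is_code n w C \<longleftrightarrow> C \<subseteq> johnson_verts n w \<and> C \<noteq> {}"

definition code_dist :: "nat \<Rightarrow> nat \<Rightarrow> nat set set \<Rightarrow> nat set \<Rightarrow> nat" where
  "code_dist n w C x = (INF c\<in>C. johnson_dist n w x c)"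

definition code_layer :: "nat \<Rightarrow> nat \<Rightarrow> nat set set \<Rightarrow> nat \<Rightarrow> nat set set" where
  "code_layer n w C i = {x \<in> johnson_verts n w. code_dist n w C x = i}"

definition covering_radius :: "nat \<Rightarrow> nat \<Rightarrow> nat set set \<Rightarrow> nat" where
  "covering_radius n w C = Max {i. code_layer n w C i \<noteq> {}}"

definition layer_nbrs :: "nat \<Rightarrow> nat \<Rightarrow> nat set set \<Rightarrow> nat set \<Rightarrow> nat \<Rightarrow> nat" where
  "layer_nbrs n w C x j = card {y \<in> code_layer n w C j. (x, y) \<in> johnson_edges n w}"

(* No condition is imposed on \<gamma> 0: there is no layer before C itself. *)
definition completely_regular :: "nat \<Rightarrow> nat \<Rightarrow> nat set set \<Rightarrow> bool" where
  "completely_regular n w C \<longleftrightarrow> is_code n w C \<and>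
     (\<exists>\<alpha> \<beta> \<gamma> :: nat \<Rightarrow> nat. \<forall>i \<le> covering_radius n w C. \<forall>x \<in> code_layer n w C i.
        layer_nbrs n w C x i = \<alpha> i \<and>
        layer_nbrs n w C x (Suc i) = \<beta> i \<and>
        (0 < i \<longrightarrow> layer_nbrs n w C x (i - 1) = \<gamma> i))"

(* For a completely regular code and i up to the covering radius, the layer C_i is nonempty,
   so the value is uniquely determined for j = i, i + 1, i - 1 and equals
   \<alpha>_i, \<beta>_i, \<gamma>_i respectively. *)
definition intersection_number :: "nat \<Rightarrow> nat \<Rightarrow> nat set set \<Rightarrow> nat \<Rightarrow> nat \<Rightarrow> nat" where
  "intersection_number n w C i j = (THE m. \<forall>x \<in> code_layer n w C i. layer_nbrs n w C x j = m)"

definition intersection_matrix :: "nat \<Rightarrow> nat \<Rightarrow> nat set set \<Rightarrow> complex mat" where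
  "intersection_matrix n w C =
     mat (Suc (covering_radius n w C)) (Suc (covering_radius n w C))
       (\<lambda>(i, j). if j = i \<or> j = Suc i \<or> i = Suc j
                 then of_nat (intersection_number n w C i j) else 0)"

definition code_spec :: "nat \<Rightarrow> nat \<Rightarrow> nat set set \<Rightarrow> complex set" where
  "code_spec n w C = spectrum (intersection_matrix n w C)"

(* The bound t \<le> w is needed for the maximum to exist: for t > w every t-subset lies in no
   member of C at all. *)
definition code_strength :: "nat \<Rightarrow> nat \<Rightarrow> nat set set \<Rightarrow> nat" where
  "code_strength n w C =
     Max {t. t \<le> w \<and> (\<exists>m. \<forall>T. T \<subseteq> {1..n} \<and> card T = t \<longrightarrow> card {x \<in> C. T \<subseteq> x} = m)}"

(* If C is completely regular with covering radius \<rho>, then so is C_\<rho>: its distance partition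
   is that of C in reversed order, and its intersection matrix has the same eigenvalues.
   Classifications of completely regular codes by their spectrum are therefore possible only
   up to exchanging C and C_\<rho>. *)
definition opposite_code :: "nat \<Rightarrow> nat \<Rightarrow> nat set set \<Rightarrow> nat set set" where
  "opposite_code n w C = code_layer n w C (covering_radius n w C)"

(* All halvings of {1..n} are admitted, so this is closed under permutations of {1..n}. *)
definition type_GP3' :: "nat \<Rightarrow> nat set set \<Rightarrow> bool" where
  "type_GP3' n C \<longleftrightarrow> (\<exists>Y1 Y2. Y1 \<union> Y2 = {1..n} \<and> Y1 \<inter> Y2 = {} \<and>
     2 * card Y1 = n \<and> 2 * card Y2 = n \<and>
     C = {x. card x = 4 \<and> (x \<subseteq> Y1 \<or> x \<subseteq> Y2)})"

definition M1_block :: "nat \<Rightarrow> nat set" where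
  "M1_block i = {2 * i - 1, 2 * i}"

definition M1_code :: "nat \<Rightarrow> nat set set" where
  "M1_code n = {M1_block i \<union> M1_block j | i j. i \<in> {1..n div 2} \<and> j \<in> {1..n div 2} \<and> i \<noteq> j}"

definition type_M1 :: "nat \<Rightarrow> nat set set \<Rightarrow> bool" where
  "type_M1 n C \<longleftrightarrow> even n \<and> (\<exists>\<pi>. \<pi> permutes {1..n} \<and> C = (\<lambda>x. \<pi> ` x) ` M1_code n)"

end

theory Submission
  imports Defs
begin

text \<open>
  An eigenvector u of the intersection matrix for the least eigenvalue -4 lifts to a function on the
  4-sets whose sum over the 4-sets containing any given 3-set T vanishes. These 4-sets lie in two
  consecutive layers i and i + 1, and u has no zero entry, so their numbers in either layer depend
  only on i, which we call the type of T. Every 4-set of the i-th layer then contains a constant number of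
  3-sets of type i, all others having type i - 1. As every point lies in a codeword, the covering
  radius is at most 3.

  Let lam(a, b) be the number of 3-sets of type 0 through a and b. Counting over the points and using
  that C is a 1-design but no 2-design determines the sum of lam over the pairs of a 3-set in terms
  of its type. For radius 3 this makes lam two-valued, and its support or the complement of the support
  becomes a disjoint union of cliques, where two edges from different cliques span a 4-set with a
  forbidden distribution of types. For radius 2 it gives the eigenvalue theta_2,
  and the number j of 3-sets of type 0 in a 4-set of the middle layer decides: j = 1 yields two
  disjoint cliques (GP.3'), j = 3 is the same for the opposite code, and j = 2 makes the large values
  of lam, or the small ones, a perfect matching (M.1).
\<close>

section \<open>Triples and pair degrees\<close>

text \<open>The two halves of the strength hypothesis act through \<open>pair_degree\<close>. A
  codeword through u and v contains two 3-sets through u and v, so the pair degree for type 0 is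
  proportional to the number of codewords through u and v: the 1-design property makes its sum over
  the pairs at a point constant, and the failure of the 2-design property makes it non-constant. For
  radius 2 the non-constancy forces the two possible triple sums to differ by exactly n - 4. This
  single equation puts the middle eigenvalue at 2n - 14 = theta_2, and for j = 2 it is also the gap
  between the two values of the pair degree. For radius 3 the corresponding equation contains a
  further unknown, the number of 3-sets of type 1 through the pair. It can be eliminated because no
  pair lies both in a 3-set of type 0 and in one of type 2. Negating "type 0" at radius 2 exchanges
  the outer layers and turns j into 4 - j; this is why the opposite code appears in the
  conclusion.\<close>

definition pair_degree :: "'a set \<Rightarrow> ('a set \<Rightarrow> bool) \<Rightarrow> 'a \<Rightarrow> 'a \<Rightarrow> int" where
  "pair_degree V H a b = (\<Sum>v\<in>V - {a, b}. of_bool (H {a, b, v}))"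

definition triple_count :: "('a set \<Rightarrow> bool) \<Rightarrow> 'a set \<Rightarrow> nat" where
  "triple_count H x = card {v \<in> x. H (x - {v})}"

lemma pair_degree_commute: "pair_degree V H a b = pair_degree V H b a"
  by (simp add: pair_degree_def insert_commute)

lemma triple_count_4:
  assumes "distinct [a, b, c, d]"
  shows "int (triple_count H {a, b, c, d}) =
    of_bool (H {a, b, c}) + of_bool (H {a, b, d}) + of_bool (H {a, c, d}) + of_bool (H {b, c, d})"
proof -
  have "int (triple_count H {a, b, c, d}) = (\<Sum>v\<in>{a, b, c, d}. of_bool (H ({a, b, c, d} - {v})))"
    unfolding triple_count_def by (simp add: sum.If_cases of_bool_def Int_def)
  also have "\<dots> = of_bool (H ({a, b, c, d} - {a})) + of_bool (H ({a, b, c, d} - {b}))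
     + of_bool (H ({a, b, c, d} - {c})) + of_bool (H ({a, b, c, d} - {d}))"
    using assms by (simp add: add.assoc)
  moreover have "{a, b, c, d} - {a} = {b, c, d}" "{a, b, c, d} - {b} = {a, c, d}"
    "{a, b, c, d} - {c} = {a, b, d}" "{a, b, c, d} - {d} = {a, b, c}"
    using assms by auto
  ultimately show ?thesis by simp
qed

lemma pair_degree_split:
  assumes "finite V" "c \<in> V" "distinct [a, b, c]"
  shows "pair_degree V H a b = of_bool (H {a, b, c}) + (\<Sum>d\<in>V - {a, b, c}. of_bool (H {a, b, d}))"
proof -
  have "V - {a, b} = insert c (V - {a, b, c})" using assms by auto
  thus ?thesis using assms by (simp add: pair_degree_def)
qed

text \<open>A further point d lies in three of the 3-sets inside \<open>{a, b, c, d}\<close>, one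
  for each pair of \<open>{a, b, c}\<close>. The fourth is \<open>{a, b, c}\<close> itself: it is
  removed from each summand and counted once by each of the three pair degrees.\<close>

lemma pair_degree_triple:
  assumes "finite V" "a \<in> V" "b \<in> V" "c \<in> V" "distinct [a, b, c]"
  shows "pair_degree V H a b + pair_degree V H a c + pair_degree V H b c =
    3 * of_bool (H {a, b, c}) +
    (\<Sum>d\<in>V - {a, b, c}. int (triple_count H {a, b, c, d}) - of_bool (H {a, b, c}))"
proof -
  have 1: "(\<Sum>d\<in>V - {a, b, c}. int (triple_count H {a, b, c, d}) - of_bool (H {a, b, c})) =
     (\<Sum>d\<in>V - {a, b, c}. of_bool (H {a, b, d}) + of_bool (H {a, c, d}) + of_bool (H {b, c, d}))"
    by (rule sum.cong[OF refl], subst triple_count_4) (use assms in auto)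
  have 2: "{a, c, b} = {a, b, c}" "{b, c, a} = {a, b, c}" by auto
  have "pair_degree V H a b = of_bool (H {a, b, c}) + (\<Sum>d\<in>V - {a, b, c}. of_bool (H {a, b, d}))"
    "pair_degree V H a c = of_bool (H {a, b, c}) + (\<Sum>d\<in>V - {a, b, c}. of_bool (H {a, c, d}))"
    "pair_degree V H b c = of_bool (H {a, b, c}) + (\<Sum>d\<in>V - {a, b, c}. of_bool (H {b, c, d}))"
    using pair_degree_split[of V c a b H] pair_degree_split[of V b a c H]
      pair_degree_split[of V a b c H] assms unfolding 2 by auto
  thus ?thesis unfolding 1 by (simp add: sum.distrib)
qed

lemma sum_minus_two:
  fixes f :: "'a \<Rightarrow> int"
  assumes "finite V" "b \<in> V" "a \<noteq> b"
  shows "(\<Sum>v\<in>V - {a, b}. f v) = (\<Sum>v\<in>V - {a}. f v) - f b"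
proof -
  have "V - {a} = insert b (V - {a, b})" using assms by auto
  thus ?thesis using assms by simp
qed

lemma card_minus_two:
  assumes "finite V" "a \<in> V" "b \<in> V" "a \<noteq> b"
  shows "int (card (V - {a, b})) = int (card V) - 2"
proof -
  have "card {a, b} \<le> card V" using assms by (intro card_mono) auto
  thus ?thesis using assms by (simp add: card_Diff_subset)
qed

lemma card_minus_three:
  assumes "finite V" "a \<in> V" "b \<in> V" "c \<in> V" "distinct [a, b, c]"
  shows "int (card (V - {a, b, c})) = int (card V) - 3"
proof -
  have "card {a, b, c} \<le> card V" using assms by (intro card_mono) auto
  moreover have "card {a, b, c} = 3" using assms by simp
  ultimately show ?thesis using assms by (subst card_Diff_subset) auto
qed

text \<open>The first summand is repeated N - 2 times; each of the other two sums runs over all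
  pairs at one point except a, b itself. Together this is (N - 2) * lam + 2 * (K - lam).\<close>

lemma pair_degree_sum:
  assumes "finite V" "a \<in> V" "b \<in> V" "a \<noteq> b"
    and reg: "\<And>x. x \<in> V \<Longrightarrow> (\<Sum>y\<in>V - {x}. pair_degree V H x y) = K"
  shows "(\<Sum>v\<in>V - {a, b}. pair_degree V H a b + pair_degree V H a v + pair_degree V H b v) =
    (int (card V) - 4) * pair_degree V H a b + 2 * K"
proof -
  have "(\<Sum>v\<in>V - {a, b}. pair_degree V H a v) = K - pair_degree V H a b"
    using sum_minus_two[of V b a] assms by simp
  moreover have "(\<Sum>v\<in>V - {a, b}. pair_degree V H b v) = K - pair_degree V H a b"
    using sum_minus_two[of V a b] assms pair_degree_commute[of V H a b]
    by (simp add: insert_commute)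
  ultimately show ?thesis
    unfolding sum.distrib sum_constant card_minus_two[OF assms(1-4)]
    by (simp add: algebra_simps)
qed

lemma sum_if_const:
  fixes p q :: "'b::comm_ring_1"
  assumes "finite A"
  shows "(\<Sum>v\<in>A. if P v then p else q) = p * of_nat (card {v \<in> A. P v}) + q * (of_nat (card A) - of_nat (card {v \<in> A. P v}))"
proof -
  have "card A = card {v \<in> A. P v} + card {v \<in> A. \<not> P v}"
    using assms by (subst card_Un_disjoint[symmetric]) (auto intro: arg_cong[of _ _ card])
  thus ?thesis using assms by (simp add: sum.If_cases Int_def algebra_simps)
qed

text \<open>The 3-sets with property H and the 4-sets classified by their number of such 3-sets,
  as they arise from a completely regular code of covering radius 2.\<close>

locale two_class =
  fixes V :: "'a set" and H :: "'a set \<Rightarrow> bool" and j a0 b1 :: nat and K :: int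
  assumes fin: "finite V" and card_V: "8 \<le> card V"
    and reg: "\<And>x. x \<in> V \<Longrightarrow> (\<Sum>y\<in>V - {x}. pair_degree V H x y) = K"
    and nonconst: "\<exists>a\<in>V. \<exists>b\<in>V. \<exists>c\<in>V. \<exists>d\<in>V. a \<noteq> b \<and> c \<noteq> d \<and> pair_degree V H a b \<noteq> pair_degree V H c d"
    and count: "\<And>x. x \<subseteq> V \<Longrightarrow> card x = 4 \<Longrightarrow> triple_count H x \<in> {0, j, 4}"
    and j: "1 \<le> j" "j \<le> 3"
    and full: "\<And>T. T \<subseteq> V \<Longrightarrow> card T = 3 \<Longrightarrow> H T \<Longrightarrow> card {v \<in> V - T. triple_count H (insert v T) = 4} = a0"
    and none: "\<And>T. T \<subseteq> V \<Longrightarrow> card T = 3 \<Longrightarrow> \<not> H T \<Longrightarrow> card {v \<in> V - T. triple_count H (insert v T) = 0} = b1"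
    and a0: "a0 + 4 \<le> card V" and b1: "b1 + 4 \<le> card V"
begin

abbreviation "lam \<equiv> pair_degree V H"
abbreviation "N \<equiv> int (card V)"

text \<open>The sum of the pair degrees over a 3-set with \<open>H\<close>: 3 from the set itself, 3
  from each of the \<open>a0\<close> extensions with four \<open>H\<close>-sets, and j - 1 from each
  of the remaining N - 3 - a0 extensions.\<close>

definition P :: int where "P = 3 + 3 * int a0 + (int j - 1) * (N - 3 - int a0)"
text \<open>The same sum for a 3-set without \<open>H\<close>: only the extensions with exactly j
  \<open>H\<close>-sets contribute.\<close>

definition Q :: int where "Q = int j * (N - 3 - int b1)"

lemma count_cases:
  assumes "a \<in> V" "b \<in> V" "c \<in> V" "d \<in> V" "distinct [a, b, c, d]"
  shows "triple_count H {a, b, c, d} \<in> {0, j, 4}"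
  by (rule count) (use assms in auto)

lemma lam_triple:
  assumes "a \<in> V" "b \<in> V" "c \<in> V" "distinct [a, b, c]"
  shows "lam a b + lam a c + lam b c = (if H {a, b, c} then P else Q)"
proof (cases "H {a, b, c}")
  case True
  have fd: "finite (V - {a, b, c})" using fin by simp
  have *: "(\<Sum>d\<in>V - {a, b, c}. int (triple_count H {a, b, c, d}) - of_bool (H {a, b, c})) =
    (\<Sum>d\<in>V - {a, b, c}. if triple_count H (insert d {a, b, c}) = 4 then 3 else int j - 1)"
  proof (rule sum.cong[OF refl])
    fix d assume d: "d \<in> V - {a, b, c}"
    have e: "insert d {a, b, c} = {a, b, c, d}" by auto
    show "int (triple_count H {a, b, c, d}) - of_bool (H {a, b, c}) =
      (if triple_count H (insert d {a, b, c}) = 4 then 3 else int j - 1)"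
      unfolding e using count_cases[of a b c d] triple_count_4[of a b c d H] assms d True
      by (auto simp: of_bool_def split: if_splits)
  qed
  show ?thesis
    unfolding pair_degree_triple[OF fin assms] * sum_if_const[OF fd] card_minus_three[OF fin assms]
    using True assms full[of "{a, b, c}"] by (simp add: P_def algebra_simps)
next
  case False
  have fd: "finite (V - {a, b, c})" using fin by simp
  have *: "(\<Sum>d\<in>V - {a, b, c}. int (triple_count H {a, b, c, d}) - of_bool (H {a, b, c})) =
    (\<Sum>d\<in>V - {a, b, c}. if triple_count H (insert d {a, b, c}) = 0 then 0 else int j)"
  proof (rule sum.cong[OF refl])
    fix d assume d: "d \<in> V - {a, b, c}"
    have e: "insert d {a, b, c} = {a, b, c, d}" by auto
    show "int (triple_count H {a, b, c, d}) - of_bool (H {a, b, c}) =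
      (if triple_count H (insert d {a, b, c}) = 0 then 0 else int j)"
      unfolding e using count_cases[of a b c d] triple_count_4[of a b c d H] assms d False
      by (auto simp: of_bool_def split: if_splits)
  qed
  show ?thesis
    unfolding pair_degree_triple[OF fin assms] * sum_if_const[OF fd] card_minus_three[OF fin assms]
    using False assms none[of "{a, b, c}"] by (simp add: Q_def algebra_simps)
qed

text \<open>Summing \<open>lam_triple\<close> over the third point gives a linear equation for
  \<open>lam a b\<close> alone, with coefficients independent of the pair. Two different values of
  \<open>lam\<close> satisfy it, so the coefficient of \<open>lam\<close> vanishes.\<close>

lemma P_eq: "P = Q + (N - 4)"
proof -
  have *: "(N - 4 - (P - Q)) * lam a b = (N - 2) * Q - 2 * K" if "a \<in> V" "b \<in> V" "a \<noteq> b" for a b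
  proof -
    have "(N - 4) * lam a b + 2 * K = (\<Sum>v\<in>V - {a, b}. lam a b + lam a v + lam b v)"
      by (rule pair_degree_sum[OF fin that, symmetric]) (rule reg)
    also have "\<dots> = (\<Sum>v\<in>V - {a, b}. Q + (P - Q) * of_bool (H {a, b, v}))"
      by (rule sum.cong) (use that in \<open>auto simp: lam_triple\<close>)
    also have "\<dots> = (N - 2) * Q + (P - Q) * lam a b"
      unfolding sum.distrib sum_distrib_left[symmetric] pair_degree_def[symmetric]
      unfolding sum_constant card_minus_two[OF fin that] by simp
    finally show ?thesis by (simp add: algebra_simps)
  qed
  obtain a b c d where "a \<in> V" "b \<in> V" "a \<noteq> b" "c \<in> V" "d \<in> V" "c \<noteq> d" "lam a b \<noteq> lam c d"
    using nonconst by blast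
  with *[of a b] *[of c d] have "N - 4 - (P - Q) = 0" by (metis mult_left_cancel)
  thus ?thesis by simp
qed

text \<open>Negation exchanges the 4-sets with four and with no \<open>H\<close>-sets, hence
  \<open>a0\<close> and \<open>b1\<close>, and turns each pair degree into N - 2 - lam. For codes
  this is the passage to the opposite code.\<close>

lemma complement: "two_class V (\<lambda>T. \<not> H T) (4 - j) b1 a0 ((N - 1) * (N - 2) - K)"
proof -
  have pd: "pair_degree V (\<lambda>T. \<not> H T) a b = N - 2 - lam a b" if "a \<in> V" "b \<in> V" "a \<noteq> b" for a b
  proof -
    have "pair_degree V (\<lambda>T. \<not> H T) a b + lam a b = (\<Sum>v\<in>V - {a, b}. 1)"
      unfolding pair_degree_def sum.distrib[symmetric] by (rule sum.cong) auto
    thus ?thesis using card_minus_two[OF fin that] by simp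
  qed
  have tc: "triple_count (\<lambda>T. \<not> H T) x = 4 - triple_count H x" "triple_count H x \<le> 4" if "card x = 4" for x
  proof -
    have "finite x" using that card.infinite by fastforce
    hence "triple_count (\<lambda>T. \<not> H T) x + triple_count H x = card x"
      unfolding triple_count_def
      by (subst card_Un_disjoint[symmetric]) (auto intro: arg_cong[of _ _ card])
    thus "triple_count (\<lambda>T. \<not> H T) x = 4 - triple_count H x" "triple_count H x \<le> 4"
      using that by auto
  qed
  have tci: "triple_count (\<lambda>T. \<not> H T) (insert v T) = 4 - triple_count H (insert v T)"
    "triple_count H (insert v T) \<le> 4"
    if "T \<subseteq> V" "card T = 3" "v \<in> V - T" for v T
  proof -
    have "finite T" using that(1) fin finite_subset by blast
    hence "card (insert v T) = 4" using that by simp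
    thus "triple_count (\<lambda>T. \<not> H T) (insert v T) = 4 - triple_count H (insert v T)"
      "triple_count H (insert v T) \<le> 4" by (auto simp: tc)
  qed
  show ?thesis
  proof
    fix x assume x: "x \<in> V"
    have "(\<Sum>y\<in>V - {x}. pair_degree V (\<lambda>T. \<not> H T) x y) = (\<Sum>y\<in>V - {x}. N - 2 - lam x y)"
      by (rule sum.cong) (use x in \<open>auto simp: pd\<close>)
    also have "\<dots> = (N - 1) * (N - 2) - K"
      using x fin card_V by (simp add: sum_subtractf reg of_nat_diff)
    finally show "(\<Sum>y\<in>V - {x}. pair_degree V (\<lambda>T. \<not> H T) x y) = (N - 1) * (N - 2) - K" .
  next
    obtain a b c d where "a \<in> V" "b \<in> V" "a \<noteq> b" "c \<in> V" "d \<in> V" "c \<noteq> d" "lam a b \<noteq> lam c d"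
      using nonconst by blast
    thus "\<exists>a\<in>V. \<exists>b\<in>V. \<exists>c\<in>V. \<exists>d\<in>V. a \<noteq> b \<and> c \<noteq> d \<and>
       pair_degree V (\<lambda>T. \<not> H T) a b \<noteq> pair_degree V (\<lambda>T. \<not> H T) c d"
      by (intro bexI[of _ a] bexI[of _ b] bexI[of _ c] bexI[of _ d]) (auto simp: pd)
  next
    fix x assume "x \<subseteq> V" "card x = 4"
    thus "triple_count (\<lambda>T. \<not> H T) x \<in> {0, 4 - j, 4}" using count[of x] by (auto simp: tc)
  next
    fix T assume T: "T \<subseteq> V" "card T = 3" "\<not> H T"
    hence "{v \<in> V - T. triple_count (\<lambda>T. \<not> H T) (insert v T) = 4} = {v \<in> V - T. triple_count H (insert v T) = 0}"
      using tci[of T] by force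
    thus "card {v \<in> V - T. triple_count (\<lambda>T. \<not> H T) (insert v T) = 4} = b1" using none T by simp
  next
    fix T assume T: "T \<subseteq> V" "card T = 3" "\<not> \<not> H T"
    hence "{v \<in> V - T. triple_count (\<lambda>T. \<not> H T) (insert v T) = 0} = {v \<in> V - T. triple_count H (insert v T) = 4}"
      using tci[of T] by force
    thus "card {v \<in> V - T. triple_count (\<lambda>T. \<not> H T) (insert v T) = 0} = a0" using full T by simp
  qed (use fin card_V j a0 b1 in auto)
qed

end

lemma obtain_fresh:
  assumes "finite S" "card S < card V"
  obtains x where "x \<in> V" "x \<notin> S"
proof -
  have "\<not> V \<subseteq> S" using assms card_mono[of S V] by auto
  thus ?thesis using that by blast
qed

lemma card_3_iff_set: "card T = 3 \<longleftrightarrow> (\<exists>a b c. T = {a, b, c} \<and> distinct [a, b, c])"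
  by (auto simp: card_3_iff)

text \<open>By \<open>e\<close> no 3-set contains two R-pairs, so a point has at most one partner;
  regularity and the pair p, q give every point exactly one. The same equation shows that
  \<open>G\<close> holds precisely for the 3-sets containing an R-pair.\<close>

lemma matching_of_regular:
  assumes "finite V" and sym: "\<And>a b. R a b \<Longrightarrow> R b a"
    and reg: "\<And>a. a \<in> V \<Longrightarrow> card {b \<in> V - {a}. R a b} = k"
    and ex: "p \<in> V" "q \<in> V" "p \<noteq> q" "R p q"
    and e: "\<And>a b c. a \<in> V \<Longrightarrow> b \<in> V \<Longrightarrow> c \<in> V \<Longrightarrow> distinct [a, b, c] \<Longrightarrow>
      of_bool (R a b) + of_bool (R a c) + of_bool (R b c) = (of_bool (G {a, b, c}) :: int)"
  obtains \<mu> where "\<And>a. a \<in> V \<Longrightarrow> \<mu> a \<in> V \<and> \<mu> a \<noteq> a \<and> \<mu> (\<mu> a) = a"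
    "\<And>T. T \<subseteq> V \<Longrightarrow> card T = 3 \<Longrightarrow> G T \<longleftrightarrow> (\<exists>a\<in>T. \<mu> a \<in> T)"
proof -
  have uniq: "\<not> (R a b \<and> R a c)" if "a \<in> V" "b \<in> V" "c \<in> V" "distinct [a, b, c]" for a b c
    using e[OF that] by (auto simp: of_bool_def split: if_splits)
  have "k > 0" using reg[OF ex(1)] ex assms(1) by (auto simp: card_gt_0_iff)
  hence "\<exists>b. b \<in> V - {a} \<and> R a b" if "a \<in> V" for a
    using reg[OF that] by (metis (mono_tags, lifting) card.empty empty_Collect_eq less_irrefl)
  then obtain \<mu> where \<mu>: "\<And>a. a \<in> V \<Longrightarrow> \<mu> a \<in> V - {a} \<and> R a (\<mu> a)" by metis
  have eq: "R a b \<longleftrightarrow> b = \<mu> a" if "a \<in> V" "b \<in> V" "a \<noteq> b" for a b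
    using \<mu>[of a] uniq[of a b "\<mu> a"] that by (cases "b = \<mu> a") auto
  have inv: "\<mu> (\<mu> a) = a" if "a \<in> V" for a
    using eq[of "\<mu> a" a] \<mu>[of a] that sym[of a "\<mu> a"] by auto
  have "G T \<longleftrightarrow> (\<exists>a\<in>T. \<mu> a \<in> T)" if "T \<subseteq> V" "card T = 3" for T
  proof -
    obtain x y z where T: "T = {x, y, z}" "distinct [x, y, z]"
      using \<open>card T = 3\<close> unfolding card_3_iff_set by blast
    have V: "x \<in> V" "y \<in> V" "z \<in> V" using T that by auto
    have "G T \<longleftrightarrow> R x y \<or> R x z \<or> R y z"
      using e[OF V T(2)] T(1) by (auto simp: of_bool_def split: if_splits)
    also have "\<dots> \<longleftrightarrow> y = \<mu> x \<or> z = \<mu> x \<or> z = \<mu> y"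
      using eq[of x y] eq[of x z] eq[of y z] V T(2) by simp
    also have "\<dots> \<longleftrightarrow> (\<exists>a\<in>T. \<mu> a \<in> T)"
      using \<mu>[OF V(1)] \<mu>[OF V(2)] \<mu>[OF V(3)] inv[OF V(1)] inv[OF V(2)] inv[OF V(3)] T by auto
    finally show ?thesis .
  qed
  thus ?thesis using that[of \<mu>] \<mu> inv by blast
qed

section \<open>Radius 2: two cliques for j = 1, a perfect matching for j = 2\<close>

context two_class
begin

text \<open>For j = 1 no 4-set has exactly two or three \<open>H\<close>-sets, so two of them force
  all four.\<close>

lemma count_1:
  assumes "j = 1" "a \<in> V" "b \<in> V" "c \<in> V" "d \<in> V" "distinct [a, b, c, d]"
    "H {a, b, c}" "H {a, b, d}"
  shows "H {a, c, d}" "H {b, c, d}"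
  using count_cases[of a b c d] triple_count_4[of a b c d H] assms
  by (auto simp: of_bool_def split: if_splits)

text \<open>For j = 1 a further point d makes \<open>{a, b, d}\<close> an \<open>H\<close>-set
  exactly if all four 3-sets of \<open>{a, b, c, d}\<close> are; so the pair degree counts c and the
  \<open>a0\<close> full extensions.\<close>

lemma lam_eq_a0:
  assumes "j = 1" "a \<in> V" "b \<in> V" "c \<in> V" "distinct [a, b, c]" "H {a, b, c}"
  shows "lam a b = 1 + int a0"
proof -
  have "(\<Sum>d\<in>V - {a, b, c}. of_bool (H {a, b, d})) =
    (\<Sum>d\<in>V - {a, b, c}. of_bool (triple_count H (insert d {a, b, c}) = 4) :: int)"
  proof (rule sum.cong[OF refl])
    fix d assume d: "d \<in> V - {a, b, c}"
    have e: "insert d {a, b, c} = {a, b, c, d}" by auto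
    show "of_bool (H {a, b, d}) = (of_bool (triple_count H (insert d {a, b, c}) = 4) :: int)"
      unfolding e using count_cases[of a b c d] triple_count_4[of a b c d H] assms d
      by (auto simp: of_bool_def split: if_splits)
  qed
  also have "\<dots> = int (card {d \<in> V - {a, b, c}. triple_count H (insert d {a, b, c}) = 4})"
    using fin by (simp add: of_bool_def sum.If_cases Int_def)
  also have "\<dots> = int a0"
    by (subst full) (use assms in auto)
  finally show ?thesis using pair_degree_split[of V c a b H] assms fin by simp
qed

lemma lam_cases_1:
  assumes "j = 1" "a \<in> V" "b \<in> V" "a \<noteq> b"
  shows "lam a b = 0 \<or> lam a b = 1 + int a0"
proof (cases "\<exists>c\<in>V - {a, b}. H {a, b, c}")
  case True
  thus ?thesis using lam_eq_a0 assms by fastforce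
next
  case False
  thus ?thesis by (simp add: pair_degree_def)
qed

text \<open>Join two points if their pair degree is the nonzero value s. An \<open>H\<close>-set is
  a triangle, every other 3-set has total weight Q. Once Q = s is known, every 3-set has one or
  three edges: adjacency is an equivalence relation with two classes, and equal degrees make them
  equally large.\<close>

lemma two_cliques:
  assumes "j = 1"
  obtains Y1 Y2 where "Y1 \<union> Y2 = V" "Y1 \<inter> Y2 = {}" "card Y1 = card Y2"
    "\<forall>T. T \<subseteq> V \<longrightarrow> card T = 3 \<longrightarrow> H T \<longleftrightarrow> T \<subseteq> Y1 \<or> T \<subseteq> Y2"
proof -
  define s where "s = 1 + int a0"
  have s: "s > 0" by (simp add: s_def)
  have c01: "lam a b = 0 \<or> lam a b = s" if "a \<in> V" "b \<in> V" "a \<noteq> b" for a b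
    using lam_cases_1 assms that unfolding s_def by blast
  have Hs: "lam a b = s" "lam a c = s" "lam b c = s"
    if "a \<in> V" "b \<in> V" "c \<in> V" "distinct [a, b, c]" "H {a, b, c}" for a b c
    using lam_eq_a0[of a b c] lam_eq_a0[of a c b] lam_eq_a0[of b c a] assms that
    unfolding s_def by (auto simp: insert_commute)
  have nH: "lam a b + lam a c + lam b c = Q"
    if "a \<in> V" "b \<in> V" "c \<in> V" "distinct [a, b, c]" "\<not> H {a, b, c}" for a b c
    using lam_triple[of a b c] that by simp
  have Qpos: "Q > 0" unfolding Q_def using assms b1 by simp
  obtain c d where cd: "c \<in> V" "d \<in> V" "c \<noteq> d" "lam c d = 0"
    using nonconst c01 by metis
  have cdx: "lam c x + lam d x = Q" if "x \<in> V" "x \<noteq> c" "x \<noteq> d" for x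
  proof -
    have "\<not> H {c, d, x}" using Hs(1)[of c d x] cd that s by auto
    thus ?thesis using nH[of c d x] cd that by simp
  qed
  \<comment> \<open>The non-edge cd leaves only Q = s and Q = 2s. In the latter case c and d are
    joined to all other points. An edge ab among those makes \<open>{a, b, c}\<close> and
    \<open>{a, b, d}\<close> triangles of weight 3s, hence \<open>H\<close>-sets, and
    \<open>count_1\<close> contradicts \<open>lam c d = 0\<close>; with no such edge three further
    points have weight 0 instead of Q or 3s.\<close>
  have Qs: "Q = s"
  proof (rule ccontr)
    assume "Q \<noteq> s"
    obtain x where x: "x \<in> V" "x \<notin> {c, d}"
      by (rule obtain_fresh[of "{c, d}" V]) (use cd card_V in auto)
    hence Q2: "Q = 2 * s"
      using cdx[of x] c01[of c x] c01[of d x] cd \<open>Q \<noteq> s\<close> Qpos by auto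
    have adj: "lam c x = s" "lam d x = s" if "x \<in> V" "x \<noteq> c" "x \<noteq> d" for x
      using cdx[of x] c01[of c x] c01[of d x] cd that Q2 s by auto
    obtain y where y: "y \<in> V" "y \<notin> {c, d, x}"
      by (rule obtain_fresh[of "{c, d, x}" V]) (use cd x card_V in \<open>auto simp: card_insert_if\<close>)
    obtain z where z: "z \<in> V" "z \<notin> {c, d, x, y}"
      by (rule obtain_fresh[of "{c, d, x, y}" V]) (use cd x y card_V in \<open>auto simp: card_insert_if\<close>)
    have bad: False if "a \<in> V" "b \<in> V" "distinct [a, b, c, d]" "lam a b = s" for a b
    proof -
      have "lam a c = s" "lam b c = s" "lam a d = s" "lam b d = s"
        using adj[of a] adj[of b] that by (auto simp: pair_degree_commute[of V H _ c] pair_degree_commute[of V H _ d])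
      hence "H {a, b, c}" "H {a, b, d}"
        using nH[of a b c] nH[of a b d] that cd Q2 s by (cases "H {a, b, c}"; cases "H {a, b, d}"; simp)+
      hence "H {a, c, d}" using count_1[of a b c d] assms that cd by auto
      thus False using Hs(3)[of a c d] that cd s by auto
    qed
    have "lam x y = 0" "lam x z = 0" "lam y z = 0"
      using bad[of x y] bad[of x z] bad[of y z] c01[of x y] c01[of x z] c01[of y z] cd x y z by auto
    moreover have "lam x y + lam x z + lam y z > 0"
      using nH[of x y z] Hs[of x y z] x y z Qpos s by (cases "H {x, y, z}") auto
    ultimately show False by simp
  qed
  \<comment> \<open>Closed neighbourhoods. As Q = s, every point other than c and d is joined to
    exactly one of these two, so their neighbourhoods partition V.\<close>
  define Y where "Y c = {v \<in> V. v = c \<or> lam c v = s}" for c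
  have cardY: "s * (int (card (Y c)) - 1) = K" if "c \<in> V" for c
  proof -
    have Yc: "Y c = insert c {v \<in> V - {c}. lam c v = s}" using that by (auto simp: Y_def)
    have "K = (\<Sum>v\<in>V - {c}. lam c v)" using reg that by simp
    also have "\<dots> = (\<Sum>v\<in>V - {c}. if lam c v = s then s else 0)"
    proof (rule sum.cong[OF refl])
      fix x assume "x \<in> V - {c}"
      thus "lam c x = (if lam c x = s then s else 0)" using c01[of c x] that by auto
    qed
    also have "\<dots> = s * int (card {v \<in> V - {c}. lam c v = s})"
      using fin by (subst sum_if_const) auto
    finally show ?thesis unfolding Yc using fin by simp
  qed
  have part: "Y c \<union> Y d = V" "Y c \<inter> Y d = {}"
  proof -
    have 1: "lam c x = s \<longleftrightarrow> \<not> lam d x = s" if "x \<in> V" "x \<noteq> c" "x \<noteq> d" for x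
      using cdx[OF that] c01[of c x] c01[of d x] cd that s Qs by auto
    have 2: "lam c d \<noteq> s" "lam d c \<noteq> s" using cd s pair_degree_commute[of V H d c] by auto
    have "x \<in> Y c \<longleftrightarrow> x \<notin> Y d" if "x \<in> V" for x
      using 1[of x] 2 that cd unfolding Y_def by (cases "x = c"; cases "x = d") auto
    moreover have "Y c \<subseteq> V" "Y d \<subseteq> V" unfolding Y_def by auto
    ultimately show "Y c \<union> Y d = V" "Y c \<inter> Y d = {}" by blast+
  qed
  have in_Y: "lam x y = s" if "e \<in> V" "x \<in> Y e" "y \<in> Y e" "x \<noteq> y" for e x y
  proof (cases "e = x \<or> e = y")
    case True
    thus ?thesis using that unfolding Y_def by (auto simp: pair_degree_commute[of V H y x])
  next
    case False
    hence "lam e x = s" "lam e y = s" "x \<in> V" "y \<in> V" using that unfolding Y_def by auto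
    thus ?thesis using nH[of e x y] Hs[of e x y] that False Qs s c01[of x y]
      by (cases "H {e, x, y}") auto
  qed
  have step: "y \<in> Y c" if "x \<in> Y c" "y \<in> V" "x \<noteq> y" "lam x y = s" for x y
  proof (cases "c = x \<or> c = y")
    case True
    thus ?thesis using that cd unfolding Y_def by auto
  next
    case False
    hence "lam c x = s" "x \<in> V" using that unfolding Y_def by auto
    hence "lam c y = s"
      using nH[of c x y] Hs[of c x y] that False Qs s c01[of c y] cd
      by (cases "H {c, x, y}") auto
    thus ?thesis using that unfolding Y_def by auto
  qed
  have same: "x \<in> Y c \<longleftrightarrow> y \<in> Y c" if "x \<in> V" "y \<in> V" "x \<noteq> y" "lam x y = s" for x y
    using step[of x y] step[of y x] that pair_degree_commute[of V H y x] by metis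
  have "H T \<longleftrightarrow> T \<subseteq> Y c \<or> T \<subseteq> Y d" if "T \<subseteq> V" "card T = 3" for T
  proof -
    obtain x y z where T: "T = {x, y, z}" "distinct [x, y, z]"
      using \<open>card T = 3\<close> unfolding card_3_iff_set by blast
    have V: "x \<in> V" "y \<in> V" "z \<in> V" using T that by auto
    show ?thesis
    proof
      assume "H T"
      hence "lam x y = s" "lam x z = s" "lam y z = s" using Hs V T by auto
      hence "x \<in> Y c \<longleftrightarrow> y \<in> Y c" "x \<in> Y c \<longleftrightarrow> z \<in> Y c"
        using same[of x y] same[of x z] T(2) V by auto
      thus "T \<subseteq> Y c \<or> T \<subseteq> Y d" using T V part by auto
    next
      assume "T \<subseteq> Y c \<or> T \<subseteq> Y d"
      hence "lam x y = s" "lam x z = s" "lam y z = s"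
        using in_Y[of c] in_Y[of d] cd T by auto
      thus "H T" using nH[of x y z] V T Qs s by auto
    qed
  qed
  moreover have "card (Y c) = card (Y d)" using cardY[of c] cardY[of d] cd s by auto
  ultimately show ?thesis using that part by blast
qed

lemma lam_bounds:
  assumes "a \<in> V" "b \<in> V" "a \<noteq> b"
  shows "0 \<le> lam a b" "lam a b \<le> N - 2"
proof -
  show "0 \<le> lam a b" unfolding pair_degree_def by (rule sum_nonneg) simp
  have "lam a b \<le> (\<Sum>v\<in>V - {a, b}. 1)" unfolding pair_degree_def by (rule sum_mono) simp
  thus "lam a b \<le> N - 2" using card_minus_two[OF fin assms] by simp
qed

lemma perfect_matching:
  assumes "j = 2"
  obtains \<mu> where "\<forall>a\<in>V. \<mu> a \<in> V \<and> \<mu> a \<noteq> a \<and> \<mu> (\<mu> a) = a"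
    "(\<forall>T. T \<subseteq> V \<longrightarrow> card T = 3 \<longrightarrow> H T \<longleftrightarrow> (\<exists>a\<in>T. \<mu> a \<in> T)) \<or>
     (\<forall>T. T \<subseteq> V \<longrightarrow> card T = 3 \<longrightarrow> \<not> H T \<longleftrightarrow> (\<exists>a\<in>T. \<mu> a \<in> T))"
proof -
  define D where "D = N - 4"
  have D: "D > 0" "N - 2 < 2 * D" using card_V by (auto simp: D_def)
  have tri: "lam a b + lam a c + lam b c = Q + D * of_bool (H {a, b, c})"
    if "a \<in> V" "b \<in> V" "c \<in> V" "distinct [a, b, c]" for a b c
    using lam_triple[OF that] P_eq by (auto simp: D_def)
  \<comment> \<open>In this signed combination of the four triple sums the pairs other than ab and
    cd cancel. For j = 2 every 4-set has an even number of \<open>H\<close>-sets, so the signed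
    count \<open>E\<close> is even as well.\<close>
  have disj: "\<exists>k. lam a b - lam c d = D * k"
    if "a \<in> V" "b \<in> V" "c \<in> V" "d \<in> V" "distinct [a, b, c, d]" for a b c d
  proof -
    define E :: int where "E = of_bool (H {a, b, c}) + of_bool (H {a, b, d})
        - of_bool (H {a, c, d}) - of_bool (H {b, c, d})"
    have *: "2 * (lam a b - lam c d) = D * E"
      using tri[of a b c] tri[of a b d] tri[of a c d] tri[of b c d] that
      by (simp add: E_def algebra_simps)
    have "even E"
      using count_cases[OF that] triple_count_4[OF that(5), of H] assms
      by (auto simp: E_def of_bool_def split: if_splits)
    then obtain k where "E = 2 * k" by (elim evenE)
    thus ?thesis using * by (intro exI[of _ k]) simp
  qed
  \<comment> \<open>Any two pairs are compared through a pair disjoint from both. Since 0 <= lam <=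
    N - 2 < 2D, the resulting multiple of D is 0, D or -D.\<close>
  have diff: "lam a b - lam c d \<in> {0, D, - D}"
    if "a \<in> V" "b \<in> V" "a \<noteq> b" "c \<in> V" "d \<in> V" "c \<noteq> d" for a b c d
  proof -
    obtain e where e: "e \<in> V" "e \<notin> {a, b, c, d}"
      by (rule obtain_fresh[of "{a, b, c, d}" V]) (use card_V in \<open>auto simp: card_insert_if\<close>)
    obtain f where f: "f \<in> V" "f \<notin> {a, b, c, d, e}"
      by (rule obtain_fresh[of "{a, b, c, d, e}" V]) (use card_V in \<open>auto simp: card_insert_if\<close>)
    have "\<exists>k. lam a b - lam e f = D * k" "\<exists>k. lam c d - lam e f = D * k"
      using that e f by (intro disj; auto)+
    then obtain k l where "lam a b - lam e f = D * k" "lam c d - lam e f = D * l" by blast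
    hence k: "lam a b - lam c d = D * (k - l)" by (simp add: algebra_simps)
    have "D * (k - l) < D * 2" "D * (- 2) < D * (k - l)"
      unfolding k[symmetric] using lam_bounds[of a b] lam_bounds[of c d] that D(2) by auto
    hence "k - l < 2" "- 2 < k - l" using D(1) mult_less_cancel_left_pos by blast+
    hence "k - l = 0 \<or> k - l = 1 \<or> k - l = -1" by linarith
    thus ?thesis using k by auto
  qed
  obtain v p q p' q' where v: "p \<in> V" "q \<in> V" "p \<noteq> q" "lam p q = v + D"
    "p' \<in> V" "q' \<in> V" "p' \<noteq> q'" "lam p' q' = v"
  proof -
    obtain a b c d where *: "a \<in> V" "b \<in> V" "a \<noteq> b" "c \<in> V" "d \<in> V" "c \<noteq> d" "lam a b \<noteq> lam c d"
      using nonconst by blast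
    from diff[OF *(1-6)] *(7) have "lam a b = lam c d + D \<or> lam c d = lam a b + D" by auto
    thus ?thesis using that[of a b "lam c d" c d] that[of c d "lam a b" a b] * by auto
  qed
  define R where "R a b \<longleftrightarrow> lam a b = v + D" for a b
  have R_sym: "R a b \<longleftrightarrow> R b a" for a b by (simp add: R_def pair_degree_commute)
  have lamR: "lam a b = v + D * of_bool (R a b)" if "a \<in> V" "b \<in> V" "a \<noteq> b" for a b
    using diff[of a b p q] diff[of a b p' q'] v that D unfolding R_def by auto
  \<comment> \<open>The triple sum is 3v + D times the number of R-pairs on the one hand and Q + D
    times the indicator of \<open>H\<close> on the other, so the difference of the two counts is the
    same for all 3-sets.\<close>
  define i where "i a b c = (of_bool (R a b) + of_bool (R a c) + of_bool (R b c) - of_bool (H {a, b, c}) :: int)" for a b c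
  have "D * i a b c = Q - 3 * v" if "a \<in> V" "b \<in> V" "c \<in> V" "distinct [a, b, c]" for a b c
    using tri[OF that] that unfolding i_def by (simp add: lamR algebra_simps)
  then obtain i0 where i0: "i a b c = i0" if "a \<in> V" "b \<in> V" "c \<in> V" "distinct [a, b, c]" for a b c
    using D by (metis less_irrefl mult_left_cancel)
  have regR: "D * int (card {b \<in> V - {a}. R a b}) = K - (N - 1) * v" if "a \<in> V" for a
  proof -
    have "K = (\<Sum>b\<in>V - {a}. lam a b)" using reg that by simp
    also have "\<dots> = (\<Sum>b\<in>V - {a}. v + D * of_bool (R a b))"
      by (rule sum.cong) (use lamR that in auto)
    also have "\<dots> = (N - 1) * v + D * int (card {b \<in> V - {a}. R a b})"
      using fin that card_V
      by (simp add: sum.distrib of_nat_diff flip: sum_distrib_left)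
        (simp add: of_bool_def sum.If_cases Int_def)
    finally show ?thesis by simp
  qed
  have regR2: "card {b \<in> V - {a}. R a b} = card {b \<in> V - {p}. R p b}" if "a \<in> V" for a
  proof -
    have "D * int (card {b \<in> V - {a}. R a b}) = D * int (card {b \<in> V - {p}. R p b})"
      using regR[OF that] regR[OF v(1)] by presburger
    thus ?thesis using D(1) by simp
  qed
  have regnR: "int (card {b \<in> V - {a}. \<not> R a b}) = N - 1 - int (card {b \<in> V - {p}. R p b})" if "a \<in> V" for a
  proof -
    have "card {b \<in> V - {a}. \<not> R a b} + card {b \<in> V - {a}. R a b} = card (V - {a})"
      using fin by (subst card_Un_disjoint[symmetric]) (auto intro: arg_cong[of _ _ card])
    thus ?thesis using regR2[OF that] fin that card_V by (simp add: of_nat_diff)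
  qed
  \<comment> \<open>A 3-set through p, q has at least one R-pair, so i0 >= 0; a 3-set through p', q'
    has at most two, so i0 <= 2.\<close>
  have "i0 = 0 \<or> i0 = 1 \<or> i0 = 2"
  proof -
    obtain r where r: "r \<in> V" "r \<notin> {p, q}"
      by (rule obtain_fresh[of "{p, q}" V]) (use card_V v in auto)
    obtain r' where r': "r' \<in> V" "r' \<notin> {p', q'}"
      by (rule obtain_fresh[of "{p', q'}" V]) (use card_V v in auto)
    have "R p q" "\<not> R p' q'" using v D by (auto simp: R_def)
    thus ?thesis using i0[of p q r] i0[of p' q' r'] v r r' unfolding i_def
      by (auto simp: of_bool_def split: if_splits)
  qed
  moreover have "i0 \<noteq> 1"
  \<comment> \<open>Otherwise R has neither triangles nor independent triples, against Ramsey's R(3,3) = 6.\<close>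
  proof
    assume "i0 = 1"
    hence e: "(R a b \<or> R a c \<or> R b c) \<and> \<not> (R a b \<and> R a c \<and> R b c)"
      if "a \<in> V" "b \<in> V" "c \<in> V" "distinct [a, b, c]" for a b c
      using i0[OF that] unfolding i_def by (auto simp: of_bool_def split: if_splits)
    \<comment> \<open>Three R-neighbours of a would be an independent triple, three non-neighbours a
      triangle. Five further points cannot avoid both; all ten of their triples are listed
      below.\<close>
    have e3: "(R a b \<or> R a c \<or> R a d) \<and> \<not> (R a b \<and> R a c \<and> R a d)"
      if "a \<in> V" "b \<in> V" "c \<in> V" "d \<in> V" "distinct [a, b, c, d]" for a b c d
      using e[of a b c] e[of a b d] e[of a c d] e[of b c d] that by auto
    obtain a where a: "a \<in> V"
      by (rule obtain_fresh[of "{}" V]) (use card_V in auto)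
    obtain b where b: "b \<in> V" "b \<notin> {a}"
      by (rule obtain_fresh[of "{a}" V]) (use card_V in auto)
    obtain c where c: "c \<in> V" "c \<notin> {a, b}"
      by (rule obtain_fresh[of "{a, b}" V]) (use card_V in \<open>auto simp: card_insert_if\<close>)
    obtain d where d: "d \<in> V" "d \<notin> {a, b, c}"
      by (rule obtain_fresh[of "{a, b, c}" V]) (use card_V in \<open>auto simp: card_insert_if\<close>)
    obtain x where x: "x \<in> V" "x \<notin> {a, b, c, d}"
      by (rule obtain_fresh[of "{a, b, c, d}" V]) (use card_V in \<open>auto simp: card_insert_if\<close>)
    obtain y where y: "y \<in> V" "y \<notin> {a, b, c, d, x}"
      by (rule obtain_fresh[of "{a, b, c, d, x}" V]) (use card_V in \<open>auto simp: card_insert_if\<close>)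
    have m: "\<not> (R a u = R a v \<and> R a v = R a w)"
      if "u \<in> V" "v \<in> V" "w \<in> V" "distinct [a, u, v, w]" for u v w
      using e3[OF a that] by blast
    have ne: "distinct [a, b, c, d, x, y]" using b c d x y by auto
    have "\<not> (R a b = R a c \<and> R a c = R a d)" "\<not> (R a b = R a c \<and> R a c = R a x)"
      "\<not> (R a b = R a c \<and> R a c = R a y)" "\<not> (R a b = R a d \<and> R a d = R a x)"
      "\<not> (R a b = R a d \<and> R a d = R a y)" "\<not> (R a b = R a x \<and> R a x = R a y)"
      "\<not> (R a c = R a d \<and> R a d = R a x)" "\<not> (R a c = R a d \<and> R a d = R a y)"
      "\<not> (R a c = R a x \<and> R a x = R a y)" "\<not> (R a d = R a x \<and> R a x = R a y)"
      by (intro m; use b c d x y ne in simp)+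
    thus False by blast
  qed
  \<comment> \<open>For i0 = 0 every 3-set has one R-pair or none, according to \<open>H\<close>;
    for i0 = 2 the same holds for the complements of R and \<open>H\<close>.\<close>
  ultimately consider "i0 = 0" | "i0 = 2" by blast
  thus ?thesis
  proof cases
    case 1
    show ?thesis
    proof (rule matching_of_regular[OF fin, of R _ p q H])
      show "R b a" if "R a b" for a b using that R_sym by blast
      show "R p q" using v by (simp add: R_def)
      show "card {b \<in> V - {a}. R a b} = card {b \<in> V - {p}. R p b}" if "a \<in> V" for a
        by (rule regR2[OF that])
      show "of_bool (R a b) + of_bool (R a c) + of_bool (R b c) = (of_bool (H {a, b, c}) :: int)"
        if "a \<in> V" "b \<in> V" "c \<in> V" "distinct [a, b, c]" for a b c
        using i0[OF that] 1 unfolding i_def by simp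
    qed (use v that in blast)+
  next
    case 2
    show ?thesis
    proof (rule matching_of_regular[OF fin, of "\<lambda>a b. \<not> R a b" _ p' q' "\<lambda>T. \<not> H T"])
      show "\<not> R b a" if "\<not> R a b" for a b using that R_sym by blast
      show "\<not> R p' q'" using v D by (simp add: R_def)
      show "card {b \<in> V - {a}. \<not> R a b} = nat (N - 1 - int (card {b \<in> V - {p}. R p b}))" if "a \<in> V" for a
        using regnR[OF that] by linarith
      show "of_bool (\<not> R a b) + of_bool (\<not> R a c) + of_bool (\<not> R b c) = (of_bool (\<not> H {a, b, c}) :: int)"
        if "a \<in> V" "b \<in> V" "c \<in> V" "distinct [a, b, c]" for a b c
        using i0[OF that] 2 unfolding i_def by (auto simp: of_bool_def split: if_splits)
    qed (use v that in blast)+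
  qed
qed

end

section \<open>The covering radius\<close>

lemma sum_supersets:
  assumes "finite V" "T \<subseteq> V" "card T = m"
  shows "(\<Sum>x | x \<subseteq> V \<and> card x = Suc m \<and> T \<subseteq> x. g x) = (\<Sum>w\<in>V - T. g (insert w T))"
proof (rule sum.reindex_cong[where l = "\<lambda>w. insert w T"])
  have fT: "finite T" using assms finite_subset by blast
  show "inj_on (\<lambda>w. insert w T) (V - T)" by (auto simp: inj_on_def)
  show "{x. x \<subseteq> V \<and> card x = Suc m \<and> T \<subseteq> x} = (\<lambda>w. insert w T) ` (V - T)"
  proof (intro equalityI subsetI)
    fix x assume x: "x \<in> {x. x \<subseteq> V \<and> card x = Suc m \<and> T \<subseteq> x}"
    hence "card (x - T) = 1" using fT assms by (simp add: card_Diff_subset)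
    then obtain w where "x - T = {w}" by (auto simp: card_1_singleton_iff)
    hence "x = insert w T" "w \<in> V - T" using x by auto
    thus "x \<in> (\<lambda>w. insert w T) ` (V - T)" by blast
  qed (use assms fT in auto)
qed simp

lemma card_supersets:
  assumes "finite V" "T \<subseteq> V" "card T = m"
  shows "card {x. x \<subseteq> V \<and> card x = Suc m \<and> T \<subseteq> x \<and> P x} = card {w \<in> V - T. P (insert w T)}"
proof -
  have "finite {x. x \<subseteq> V \<and> card x = Suc m \<and> T \<subseteq> x}"
    by (rule finite_subset[of _ "Pow V"]) (use assms in auto)
  hence "card {x. x \<subseteq> V \<and> card x = Suc m \<and> T \<subseteq> x \<and> P x} =
    (\<Sum>x | x \<subseteq> V \<and> card x = Suc m \<and> T \<subseteq> x. if P x then 1 else 0)"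
    by (subst sum.If_cases) (auto intro: arg_cong[of _ _ card])
  also have "\<dots> = (\<Sum>w\<in>V - T. if P (insert w T) then 1 else 0)"
    by (rule sum_supersets[OF assms])
  also have "\<dots> = card {w \<in> V - T. P (insert w T)}"
    using assms by (subst sum.If_cases) (auto intro: arg_cong[of _ _ card])
  finally show ?thesis .
qed

text \<open>Both sides count the members of F above S together with one of their points outside
  S.\<close>

lemma sum_card_extensions:
  assumes "finite V" "finite S" "\<And>x. x \<in> F \<Longrightarrow> x \<subseteq> V \<and> card x = m"
  shows "(\<Sum>b\<in>V - S. card {x \<in> F. insert b S \<subseteq> x}) = (m - card S) * card {x \<in> F. S \<subseteq> x}"
proof -
  have finF: "finite F" by (rule finite_subset[of _ "Pow V"]) (use assms in auto)
  have "(\<Sum>b\<in>V - S. card {x \<in> F. insert b S \<subseteq> x}) =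
    (\<Sum>b\<in>V - S. \<Sum>x | x \<in> F \<and> S \<subseteq> x. if b \<in> x then 1 else 0)"
    using finF by (intro sum.cong[OF refl], subst sum.If_cases) (auto intro: arg_cong[of _ _ card])
  also have "\<dots> = (\<Sum>x | x \<in> F \<and> S \<subseteq> x. \<Sum>b\<in>V - S. if b \<in> x then 1 else 0)"
    by (rule sum.swap)
  also have "\<dots> = (\<Sum>x | x \<in> F \<and> S \<subseteq> x. m - card S)"
  proof (rule sum.cong[OF refl])
    fix x assume x: "x \<in> {x. x \<in> F \<and> S \<subseteq> x}"
    have "(\<Sum>b\<in>V - S. if b \<in> x then 1 else 0) = card {b \<in> V - S. b \<in> x}"
      using assms(1) by (subst sum.If_cases) (auto intro: arg_cong[of _ _ card])
    also have "{b \<in> V - S. b \<in> x} = x - S" using x assms(3)[of x] by auto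
    also have "card (x - S) = m - card S" using x assms(2,3) by (simp add: card_Diff_subset)
    finally show "(\<Sum>b\<in>V - S. if b \<in> x then 1 else 0) = m - card S" .
  qed
  finally show ?thesis by simp
qed

text \<open>What the eigenvalue -4 forces on the distance partition d of the 4-sets: every 3-set T has
  a type, and the 4-sets containing T lie in the layers tau T and tau T + 1.\<close>

locale layered =
  fixes V :: "'a set" and d \<tau> :: "'a set \<Rightarrow> nat" and a k :: "nat \<Rightarrow> nat" and \<rho> r :: nat
  assumes fin: "finite V" and card_V: "8 \<le> card V"
    and up: "\<And>T v. T \<subseteq> V \<Longrightarrow> card T = 3 \<Longrightarrow> v \<in> V - T \<Longrightarrow> d (insert v T) = \<tau> T \<or> d (insert v T) = Suc (\<tau> T)"
    and tau_less: "\<And>T. T \<subseteq> V \<Longrightarrow> card T = 3 \<Longrightarrow> \<tau> T < \<rho>"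
    and low: "\<And>T. T \<subseteq> V \<Longrightarrow> card T = 3 \<Longrightarrow> card {v \<in> V - T. d (insert v T) = \<tau> T} = a (\<tau> T)"
    and a_bounds: "\<And>T. T \<subseteq> V \<Longrightarrow> card T = 3 \<Longrightarrow> 1 \<le> a (\<tau> T) \<and> a (\<tau> T) + 4 \<le> card V"
    and sub: "\<And>x. x \<subseteq> V \<Longrightarrow> card x = 4 \<Longrightarrow> card {v \<in> x. \<tau> (x - {v}) = d x} = k (d x)"
    and k_bounds: "\<And>i. 0 < i \<Longrightarrow> i < \<rho> \<Longrightarrow> 1 \<le> k i \<and> k i \<le> 3"
    and onto: "\<And>i. i \<le> \<rho> \<Longrightarrow> \<exists>x. x \<subseteq> V \<and> card x = 4 \<and> d x = i"
    and design: "\<And>v. v \<in> V \<Longrightarrow> card {x. x \<subseteq> V \<and> card x = 4 \<and> d x = 0 \<and> v \<in> x} = r"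
    and no_2_design: "\<And>m. \<exists>u\<in>V. \<exists>v\<in>V. u \<noteq> v \<and> card {x. x \<subseteq> V \<and> card x = 4 \<and> d x = 0 \<and> {u, v} \<subseteq> x} \<noteq> m"
begin

abbreviation "H T \<equiv> \<tau> T = 0"
abbreviation "lam \<equiv> pair_degree V (\<lambda>T. H T)"
abbreviation "N \<equiv> int (card V)"
abbreviation "j \<equiv> 4 - k 1"

lemma up_remove:
  assumes "x \<subseteq> V" "card x = 4" "v \<in> x"
  shows "d x = \<tau> (x - {v}) \<or> d x = Suc (\<tau> (x - {v}))" "x - {v} \<subseteq> V" "card (x - {v}) = 3"
proof -
  have "finite x" using assms fin finite_subset by blast
  thus 1: "card (x - {v}) = 3" "x - {v} \<subseteq> V" using assms by auto
  have "insert v (x - {v}) = x" using assms by auto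
  thus "d x = \<tau> (x - {v}) \<or> d x = Suc (\<tau> (x - {v}))"
    using up[of "x - {v}" v] 1 assms by auto
qed

text \<open>A 4-set of layer i has only 3-sets of type i and i - 1, so type 0 occurs in layers 0 and
  1 alone. In layer 1 the \<open>k 1\<close> sets of type 1 are discarded, which is the origin of
  \<open>j\<close>.\<close>

lemma triple_count_eq:
  assumes "x \<subseteq> V" "card x = 4"
  shows "triple_count (\<lambda>T. H T) x = (if d x = 0 then 4 else if d x = 1 then j else 0)"
proof -
  have fx: "finite x" using assms fin finite_subset by blast
  consider "d x = 0" | "d x = 1" | "d x \<ge> 2" by linarith
  thus ?thesis
  proof cases
    case 1
    hence "{v \<in> x. H (x - {v})} = x" using up_remove[OF assms] by auto
    thus ?thesis using 1 assms by (simp add: triple_count_def)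
  next
    case 2
    have "{v \<in> x. H (x - {v})} = x - {v \<in> x. \<tau> (x - {v}) = d x}" using 2 up_remove[OF assms] by force
    hence "triple_count (\<lambda>T. H T) x = card x - card {v \<in> x. \<tau> (x - {v}) = d x}"
      using fx by (simp add: triple_count_def card_Diff_subset)
    thus ?thesis using 2 assms sub[OF assms] by simp
  next
    case 3
    hence e: "{v \<in> x. H (x - {v})} = {}" using up_remove[OF assms] by force
    show ?thesis using 3 unfolding triple_count_def e by simp
  qed
qed

abbreviation "C0 \<equiv> {x. x \<subseteq> V \<and> card x = 4 \<and> d x = 0}"

text \<open>Double counting of the 3-sets between \<open>{u, v}\<close> and a codeword: each
  codeword through u, v contains two of them, and each 3-set of type 0 lies in \<open>a 0\<close>
  codewords, any other in none.\<close>

lemma triple_pair_count: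
  assumes "u \<in> V" "v \<in> V" "u \<noteq> v"
  shows "2 * int (card {x \<in> C0. {u, v} \<subseteq> x}) = int (a 0) * lam u v"
proof -
  have "2 * card {x \<in> C0. {u, v} \<subseteq> x} = (\<Sum>b\<in>V - {u, v}. card {x \<in> C0. insert b {u, v} \<subseteq> x})"
    using sum_card_extensions[OF fin, of "{u, v}" C0 4] assms by simp
  also have "\<dots> = (\<Sum>b\<in>V - {u, v}. if H {u, v, b} then a 0 else 0)"
  proof (rule sum.cong[OF refl])
    fix b assume b: "b \<in> V - {u, v}"
    define T where "T = insert b {u, v}"
    have T: "T \<subseteq> V" "card T = 3" "T = {u, v, b}" using b assms by (auto simp: T_def)
    have "card {x \<in> C0. T \<subseteq> x} = card {w \<in> V - T. d (insert w T) = 0}"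
      using card_supersets[OF fin T(1,2), of "\<lambda>x. d x = 0"]
      by (simp add: conj_ac)
    also have "\<dots> = (if H T then a 0 else 0)"
    proof (cases "H T")
      case True
      thus ?thesis using low[OF T(1,2)] by simp
    next
      case False
      hence "{w \<in> V - T. d (insert w T) = 0} = {}" using up[OF T(1,2)] by force
      thus ?thesis using False by (metis card.empty)
    qed
    finally show "card {x \<in> C0. insert b {u, v} \<subseteq> x} = (if H {u, v, b} then a 0 else 0)"
      by (simp add: T_def[symmetric] T(3)[symmetric])
  qed
  finally have "2 * card {x \<in> C0. {u, v} \<subseteq> x} = (\<Sum>b\<in>V - {u, v}. if H {u, v, b} then a 0 else 0)" .
  hence "2 * int (card {x \<in> C0. {u, v} \<subseteq> x}) = int (\<Sum>b\<in>V - {u, v}. if H {u, v, b} then a 0 else 0)"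
    by linarith
  also have "\<dots> = int (a 0) * lam u v"
    unfolding pair_degree_def sum_distrib_left of_nat_sum by (rule sum.cong) auto
  finally show ?thesis .
qed

lemma a0_pos: "0 < a 0"
proof -
  obtain x where x: "x \<subseteq> V" "card x = 4" "d x = 0" using onto[of 0] by auto
  then obtain v where "v \<in> x" by fastforce
  thus ?thesis using up_remove[OF x(1,2), of v] x(3) a_bounds[of "x - {v}"] by auto
qed

text \<open>By \<open>triple_pair_count\<close> a constant \<open>lam\<close> would make the code a
  2-design.\<close>

lemma lam_nonconst: "\<exists>t\<in>V. \<exists>u\<in>V. \<exists>v\<in>V. \<exists>w\<in>V. t \<noteq> u \<and> v \<noteq> w \<and> lam t u \<noteq> lam v w"
proof (rule ccontr)
  assume neg: "\<not> ?thesis"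
  obtain p where p: "p \<in> V" by (rule obtain_fresh[of "{}" V]) (use card_V in auto)
  obtain q where q: "q \<in> V" "q \<notin> {p}" by (rule obtain_fresh[of "{p}" V]) (use card_V in auto)
  have eq: "card {x \<in> C0. {u, v} \<subseteq> x} = card {x \<in> C0. {p, q} \<subseteq> x}" if "u \<in> V" "v \<in> V" "u \<noteq> v" for u v
  proof -
    have "lam u v = lam p q"
    proof (rule ccontr)
      assume "lam u v \<noteq> lam p q"
      hence "\<exists>t\<in>V. \<exists>u\<in>V. \<exists>v\<in>V. \<exists>w\<in>V. t \<noteq> u \<and> v \<noteq> w \<and> lam t u \<noteq> lam v w"
        by (intro bexI[of _ u] bexI[of _ v] bexI[of _ p] bexI[of _ q] conjI) (use that p q in simp_all)
      thus False using neg by (rule notE[rotated])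
    qed
    thus ?thesis using triple_pair_count[OF that] triple_pair_count[of p q] p q by simp
  qed
  obtain u v where uv: "u \<in> V" "v \<in> V" "u \<noteq> v"
    "card {x. x \<subseteq> V \<and> card x = 4 \<and> d x = 0 \<and> {u, v} \<subseteq> x} \<noteq> card {x \<in> C0. {p, q} \<subseteq> x}"
    using no_2_design[of "card {x \<in> C0. {p, q} \<subseteq> x}"] by blast
  have "{x \<in> C0. {u, v} \<subseteq> x} = {x. x \<subseteq> V \<and> card x = 4 \<and> d x = 0 \<and> {u, v} \<subseteq> x}"
    by blast
  thus False using eq[OF uv(1-3)] uv(4) by simp
qed

text \<open>The chosen point is immaterial by \<open>lam_sum\<close>; a fixed choice merely yields a
  constant.\<close>

definition K :: int where "K = (\<Sum>y\<in>V - {SOME x. x \<in> V}. lam (SOME x. x \<in> V) y)"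

lemma lam_sum:
  assumes "x \<in> V"
  shows "(\<Sum>y\<in>V - {x}. lam x y) = K"
proof -
  \<comment> \<open>The 6 is 2 * 3: the factor of \<open>triple_pair_count\<close> times the three
    further points of each codeword through x.\<close>
  have *: "int (a 0) * (\<Sum>y\<in>V - {x}. lam x y) = 6 * int r" if "x \<in> V" for x
  proof -
    have "int (a 0) * (\<Sum>y\<in>V - {x}. lam x y) = (\<Sum>y\<in>V - {x}. 2 * int (card {z \<in> C0. {x, y} \<subseteq> z}))"
      unfolding sum_distrib_left by (rule sum.cong) (use triple_pair_count that in auto)
    also have "\<dots> = 2 * int (\<Sum>y\<in>V - {x}. card {z \<in> C0. insert y {x} \<subseteq> z})"
      by (simp add: sum_distrib_left insert_commute)
    also have "(\<Sum>y\<in>V - {x}. card {z \<in> C0. insert y {x} \<subseteq> z}) = 3 * card {z \<in> C0. {x} \<subseteq> z}"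
      using sum_card_extensions[OF fin, of "{x}" C0 4] by simp
    also have "card {z \<in> C0. {x} \<subseteq> z} = r" using design[OF that] by (simp add: conj_ac)
    finally show ?thesis by simp
  qed
  have "(SOME x. x \<in> V) \<in> V" using assms by (rule someI)
  from *[OF this] *[OF assms] a0_pos show ?thesis unfolding K_def
    by (metis less_irrefl mult_left_cancel of_nat_0_less_iff)
qed

lemma insert_count:
  assumes T: "T \<subseteq> V" "card T = 3" and v: "v \<in> V - T"
  shows "triple_count (\<lambda>T. H T) (insert v T) = (if d (insert v T) = 0 then 4 else if d (insert v T) = 1 then j else 0)"
proof -
  have "finite T" using T fin finite_subset by blast
  thus ?thesis using T v by (intro triple_count_eq) auto
qed

text \<open>The role of \<open>b1\<close> is played by \<open>card V - 3 - a 1\<close>, the number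
  of 4-sets of layer 2 above a 3-set of type 1.\<close>

lemma two_class:
  assumes "\<rho> = 2"
  shows "two_class V (\<lambda>T. H T) j (a 0) (card V - 3 - a 1) K"
proof
  show "1 \<le> j" "j \<le> 3" using k_bounds[of 1] assms by auto
  show "a 0 + 4 \<le> card V"
  proof -
    obtain x where x: "x \<subseteq> V" "card x = 4" "d x = 0" using onto[of 0] by auto
    then obtain v where "v \<in> x" by fastforce
    thus ?thesis using up_remove[OF x(1,2), of v] x(3) a_bounds[of "x - {v}"] by auto
  qed
  obtain x where x: "x \<subseteq> V" "card x = 4" "d x = 2" using onto[of 2] assms by auto
  then obtain v where "v \<in> x" by fastforce
  hence "\<tau> (x - {v}) = 1"
    using up_remove[OF x(1,2), of v] x(3) tau_less[of "x - {v}"] assms by auto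
  hence a1: "1 \<le> a 1" "a 1 + 4 \<le> card V"
    using a_bounds[of "x - {v}"] up_remove[OF x(1,2) \<open>v \<in> x\<close>] by auto
  thus "card V - 3 - a 1 + 4 \<le> card V" using card_V by auto
  fix T assume T: "T \<subseteq> V" "card T = 3"
  {
    assume "H T"
    have "{v \<in> V - T. triple_count (\<lambda>T. H T) (insert v T) = 4} = {v \<in> V - T. d (insert v T) = \<tau> T}"
      using insert_count[OF T] \<open>H T\<close> up[OF T] k_bounds[of 1] assms by (auto split: if_splits)
    thus "card {v \<in> V - T. triple_count (\<lambda>T. H T) (insert v T) = 4} = a 0"
      using low[OF T] \<open>H T\<close> by simp
  next
    assume "\<not> H T"
    hence t1: "\<tau> T = 1" using tau_less[OF T] assms by auto
    have "triple_count (\<lambda>T. H T) (insert v T) = 0 \<longleftrightarrow> d (insert v T) \<noteq> \<tau> T" if "v \<in> V - T" for v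
      using insert_count[OF T that] t1 up[OF T that] k_bounds[of 1] assms by auto
    hence "{v \<in> V - T. triple_count (\<lambda>T. H T) (insert v T) = 0} = (V - T) - {v \<in> V - T. d (insert v T) = \<tau> T}"
      by blast
    hence "card {v \<in> V - T. triple_count (\<lambda>T. H T) (insert v T) = 0} = card (V - T) - a 1"
      using low[OF T] t1 fin
      by (simp only:, subst card_Diff_subset) auto
    also have "card (V - T) = card V - 3" using T fin finite_subset[of T V] by (simp add: card_Diff_subset)
    finally show "card {v \<in> V - T. triple_count (\<lambda>T. H T) (insert v T) = 0} = card V - 3 - a 1" .
  }
next
  show "\<exists>a\<in>V. \<exists>b\<in>V. \<exists>c\<in>V. \<exists>d\<in>V. a \<noteq> b \<and> c \<noteq> d \<and> lam a b \<noteq> lam c d"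
    by (rule lam_nonconst)
next
  fix x assume "x \<subseteq> V" "card x = 4"
  thus "triple_count (\<lambda>T. H T) x \<in> {0, j, 4}" using triple_count_eq[of x] by auto
qed (use fin card_V lam_sum in auto)

text \<open>With radius at most 1 every 3-set has type 0, and \<open>lam\<close> is constantly N -
  2.\<close>

lemma rho_ge_2: "2 \<le> \<rho>"
proof (rule ccontr)
  assume "\<not> 2 \<le> \<rho>"
  hence "H T" if "T \<subseteq> V" "card T = 3" for T using tau_less[OF that] by simp
  hence "lam u v = N - 2" if "u \<in> V" "v \<in> V" "u \<noteq> v" for u v
  proof -
    have "lam u v = (\<Sum>w\<in>V - {u, v}. 1)"
      unfolding pair_degree_def by (rule sum.cong) (use that \<open>\<And>T. T \<subseteq> V \<Longrightarrow> card T = 3 \<Longrightarrow> H T\<close> in auto)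
    thus ?thesis using card_minus_two[OF fin that] by simp
  qed
  thus False using lam_nonconst by force
qed

lemma rho_ne_3: "\<rho> \<noteq> 3"
proof
  assume rho: "\<rho> = 3"
  have jb: "1 \<le> j" "j \<le> 3" using k_bounds[of 1] rho by auto
  define P Q where "P = 3 + 3 * int (a 0) + (int j - 1) * (N - 3 - int (a 0))" and "Q = int j * int (a 1)"
  define R where "R u v = (lam u v > 0)" for u v
  have lam_nn: "0 \<le> lam u v" for u v unfolding pair_degree_def by (rule sum_nonneg) simp
  have tau3: "\<tau> {u, v, w} \<in> {0, 1, 2}" if "u \<in> V" "v \<in> V" "w \<in> V" "distinct [u, v, w]" for u v w
    using tau_less[of "{u, v, w}"] that rho by auto
  \<comment> \<open>A 3-set of type 2 extends to layers 2 and 3 only, where type 0 does not occur.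
    Above a 3-set of type 1, just the \<open>a 1\<close> extensions in layer 1 contribute, each with
    j sets of type 0.\<close>
  have tri: "lam u v + lam u w + lam v w = (if \<tau> {u, v, w} = 0 then P else if \<tau> {u, v, w} = 1 then Q else 0)"
    if uvw: "u \<in> V" "v \<in> V" "w \<in> V" "distinct [u, v, w]" for u v w
  proof -
    define T where "T = {u, v, w}"
    have T: "T \<subseteq> V" "card T = 3" using uvw by (auto simp: T_def)
    define S where "S = (\<Sum>x\<in>V - {u, v, w}. int (triple_count (\<lambda>T. H T) {u, v, w, x}) - of_bool (H {u, v, w}))"
    define c where "c = int (card {x \<in> V - T. d (insert x T) = \<tau> T})"
    have c: "c = int (a (\<tau> T))" using low[OF T] by (simp add: c_def)
    have S: "S = (\<Sum>x\<in>V - T. if d (insert x T) = \<tau> T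
        then (if \<tau> T = 0 then 3 else if \<tau> T = 1 then int j else 0)
        else (if \<tau> T = 0 then int j - 1 else 0))"
      unfolding S_def T_def[symmetric]
    proof (rule sum.cong[OF refl])
      fix x assume x: "x \<in> V - T"
      have e: "{u, v, w, x} = insert x T" by (auto simp: T_def)
      show "int (triple_count (\<lambda>T. H T) {u, v, w, x}) - of_bool (H T) = (if d (insert x T) = \<tau> T
        then (if \<tau> T = 0 then 3 else if \<tau> T = 1 then int j else 0)
        else (if \<tau> T = 0 then int j - 1 else 0))"
        unfolding e insert_count[OF T x] using up[OF T x] jb by auto
    qed
    have "finite (V - T)" using fin by simp
    from S[unfolded sum_if_const[OF this] c_def[symmetric]]
    have S': "S = (if \<tau> T = 0 then 3 else if \<tau> T = 1 then int j else 0) * c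
        + (if \<tau> T = 0 then int j - 1 else 0) * (N - 3 - c)"
      using card_minus_three[OF fin uvw] by (simp add: T_def)
    have "lam u v + lam u w + lam v w = 3 * of_bool (H T) + S"
      unfolding S_def T_def using pair_degree_triple[OF fin uvw] by simp
    thus ?thesis unfolding S' c T_def[symmetric] P_def Q_def by simp
  qed
  \<comment> \<open>The union of the two 3-sets would lie in layer 0 or 1 and also in layer 2 or
    3.\<close>
  have adj: "\<not> (\<tau> {u, v, w} = 0 \<and> \<tau> {u, v, x} = 2)"
    if "u \<in> V" "v \<in> V" "w \<in> V" "x \<in> V" "distinct [u, v, w, x]" for u v w x
  proof -
    have "insert x {u, v, w} = insert w {u, v, x}" by auto
    thus ?thesis using up[of "{u, v, w}" x] up[of "{u, v, x}" w] that by auto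
  qed
  define t1 where "t1 u v = (\<Sum>w\<in>V - {u, v}. of_bool (\<tau> {u, v, w} = 1) :: int)" for u v
  have eqn: "(N - 4) * lam u v + 2 * K = P * lam u v + Q * t1 u v" if "u \<in> V" "v \<in> V" "u \<noteq> v" for u v
  proof -
    have "(N - 4) * lam u v + 2 * K = (\<Sum>w\<in>V - {u, v}. lam u v + lam u w + lam v w)"
      by (rule pair_degree_sum[OF fin that, symmetric]) (rule lam_sum)
    also have "\<dots> = (\<Sum>w\<in>V - {u, v}. P * of_bool (H {u, v, w}) + Q * of_bool (\<tau> {u, v, w} = 1))"
      by (rule sum.cong) (use that in \<open>auto simp: tri\<close>)
    also have "\<dots> = P * lam u v + Q * t1 u v"
      by (simp add: sum.distrib sum_distrib_left pair_degree_def t1_def)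
    finally show ?thesis .
  qed
  have lam_pos: "lam u v > 0" if "u \<in> V" "v \<in> V" "w \<in> V" "distinct [u, v, w]" "\<tau> {u, v, w} = 0" for u v w
  proof -
    have "0 \<le> (\<Sum>x\<in>V - {u, v, w}. of_bool (H {u, v, x}) :: int)" by (rule sum_nonneg) simp
    thus ?thesis using pair_degree_split[OF fin that(3,4), of "\<lambda>T. H T"] that(5) by simp
  qed
  have lam_zero: "lam u v = 0" if "u \<in> V" "v \<in> V" "w \<in> V" "distinct [u, v, w]" "\<tau> {u, v, w} = 2" for u v w
    unfolding pair_degree_def
  proof (rule sum.neutral, rule ballI)
    fix x assume "x \<in> V - {u, v}"
    thus "of_bool (H {u, v, x}) = (0 :: int)" using adj[of u v x w] that by (cases "x = w") auto
  qed
  obtain p q s where pqs: "p \<in> V" "q \<in> V" "s \<in> V" "distinct [p, q, s]" "\<tau> {p, q, s} = 0"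
  proof -
    obtain x where x: "x \<subseteq> V" "card x = 4" "d x = 0" using onto[of 0] by auto
    then obtain v where v: "v \<in> x" by fastforce
    obtain p q s where "x - {v} = {p, q, s}" "distinct [p, q, s]"
      using up_remove(3)[OF x(1,2) v] unfolding card_3_iff_set by blast
    thus ?thesis using that[of p q s] up_remove[OF x(1,2) v] x(3) by auto
  qed
  obtain p' q' s' where pqs': "p' \<in> V" "q' \<in> V" "s' \<in> V" "distinct [p', q', s']" "\<tau> {p', q', s'} = 2"
  proof -
    obtain x where x: "x \<subseteq> V" "card x = 4" "d x = 3" using onto[of 3] rho by auto
    then obtain v where v: "v \<in> x" by fastforce
    obtain p q s where pq: "x - {v} = {p, q, s}" "distinct [p, q, s]"
      using up_remove(3)[OF x(1,2) v] unfolding card_3_iff_set by blast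
    have "\<tau> (x - {v}) = 2" using up_remove[OF x(1,2) v] x(3) tau_less[of "x - {v}"] rho by auto
    thus ?thesis using that[of p q s] pq up_remove[OF x(1,2) v] by auto
  qed
  have lampq: "lam p q > 0" using lam_pos[OF pqs] .
  have lampq': "lam p' q' = 0" using lam_zero[OF pqs'] .
  have Kpos: "K > 0"
  proof -
    have "lam p q \<le> (\<Sum>y\<in>V - {p}. lam p y)"
      by (rule member_le_sum) (use pqs fin lam_nn in auto)
    thus ?thesis using lam_sum[OF pqs(1)] lampq by simp
  qed
  have Qpos: "Q > 0"
  proof -
    have "Q * t1 p' q' > 0" using eqn[of p' q'] pqs' lampq' Kpos by simp
    moreover have "Q \<ge> 0" by (simp add: Q_def)
    ultimately show ?thesis by (metis less_le mult_zero_left)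
  qed
  \<comment> \<open>The constant that remains in \<open>eqn\<close> after \<open>t1\<close> is
    eliminated. The pair p', q' has \<open>lam\<close> 0 and lies in a 3-set of type 2, so 2 * K = Q
    * t1 with t1 < N - 2; hence \<open>Z\<close> is negative.\<close>
  define Z where "Z = 2 * K - Q * (N - 2)"
  have Zneg: "Z < 0"
  proof -
    have "t1 p' q' = (\<Sum>w\<in>V - {p', q', s'}. of_bool (\<tau> {p', q', w} = 1))"
      unfolding t1_def by (rule sum.mono_neutral_right) (use fin pqs' in auto)
    also have "\<dots> \<le> (\<Sum>w\<in>V - {p', q', s'}. 1)" by (rule sum_mono) simp
    finally have "t1 p' q' < N - 2" using card_minus_three[OF fin pqs'(1-4)] by simp
    thus ?thesis using eqn[of p' q'] pqs' lampq' Qpos unfolding Z_def by simp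
  qed
  define s0 where "s0 = lam p q"
  \<comment> \<open>A pair of positive degree lies in a 3-set of type 0, so by \<open>adj\<close> in
    none of type 2, and \<open>t1 u v\<close> is N - 2 - lam. As \<open>Z\<close> is nonzero, the
    equation has only one solution, so all positive degrees coincide.\<close>
  have Zeq: "(P - (N - 4) - Q) * lam u v = Z" if "u \<in> V" "v \<in> V" "u \<noteq> v" "R u v" for u v
  proof -
    obtain w where w: "w \<in> V" "w \<notin> {u, v}" "\<tau> {u, v, w} = 0"
    proof (rule ccontr)
      assume "\<not> thesis"
      hence "\<forall>w\<in>V - {u, v}. \<not> H {u, v, w}" using that by blast
      hence "lam u v = 0" unfolding pair_degree_def by (intro sum.neutral) auto
      thus False using \<open>R u v\<close> by (simp add: R_def)
    qed
    have "\<tau> {u, v, x} \<noteq> 2" if "x \<in> V - {u, v}" for x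
      using adj[of u v w x] w \<open>u \<in> V\<close> \<open>v \<in> V\<close> \<open>u \<noteq> v\<close> that by (cases "x = w") auto
    hence "of_bool (H {u, v, x}) + of_bool (\<tau> {u, v, x} = 1) = (1 :: int)" if "x \<in> V - {u, v}" for x
      using tau3[of u v x] that \<open>u \<in> V\<close> \<open>v \<in> V\<close> \<open>u \<noteq> v\<close> by auto
    hence "lam u v + t1 u v = (\<Sum>x\<in>V - {u, v}. 1)"
      unfolding pair_degree_def t1_def sum.distrib[symmetric] by (intro sum.cong) auto
    hence t1: "t1 u v = N - 2 - lam u v" using card_minus_two[OF fin that(1-3)] by simp
    show ?thesis using eqn[OF that(1-3)] unfolding t1 Z_def by (simp add: algebra_simps)
  qed
  have lamR: "lam u v = (if R u v then s0 else 0)" if "u \<in> V" "v \<in> V" "u \<noteq> v" for u v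
  proof (cases "R u v")
    case True
    have "(P - (N - 4) - Q) * lam u v = (P - (N - 4) - Q) * s0" "P - (N - 4) - Q \<noteq> 0"
      using Zeq[OF that True] Zeq[of p q] pqs lampq Zneg unfolding R_def s0_def by auto
    thus ?thesis using True by simp
  qed (use lam_nn[of u v] in \<open>auto simp: R_def\<close>)
  have s0: "s0 > 0" using lampq by (simp add: s0_def)
  \<comment> \<open>The number of R-pairs in a 3-set. It turns out to be 3 for type 0, 0 for type 2
    and a constant \<open>m0\<close>, equal to 1 or 2, for type 1.\<close>
  define m where "m u v w = (of_bool (R u v) + of_bool (R u w) + of_bool (R v w) :: int)" for u v w
  have mQ: "s0 * m u v w = Q" if "u \<in> V" "v \<in> V" "w \<in> V" "distinct [u, v, w]" "\<tau> {u, v, w} = 1" for u v w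
    using tri[OF that(1-4)] that lamR[of u v] lamR[of u w] lamR[of v w]
    by (auto simp: m_def algebra_simps of_bool_def)
  obtain z where z: "z \<in> V" "z \<notin> {p', q'}" "\<tau> {p', q', z} = 1"
  proof (rule ccontr)
    assume "\<not> thesis"
    hence "\<forall>w\<in>V - {p', q'}. \<tau> {p', q', w} \<noteq> 1" using that by blast
    hence "t1 p' q' = 0" unfolding t1_def by (intro sum.neutral) auto
    thus False using eqn[of p' q'] pqs' lampq' Kpos by simp
  qed
  define m0 where "m0 = m p' q' z"
  have mz: "s0 * m0 = Q" unfolding m0_def using mQ[of p' q' z] z pqs' by auto
  have m0: "m0 = 1 \<or> m0 = 2"
  proof -
    have "\<not> R p' q'" using lampq' by (simp add: R_def)
    moreover have "m0 \<noteq> 0" using mz Qpos by auto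
    ultimately show ?thesis unfolding m0_def m_def by (auto simp: of_bool_def split: if_splits)
  qed
  have m1: "m u v w = m0" if "u \<in> V" "v \<in> V" "w \<in> V" "distinct [u, v, w]" "\<tau> {u, v, w} = 1" for u v w
  proof -
    have "s0 * m u v w = s0 * m0" using mQ[OF that] mz by presburger
    thus ?thesis using s0 by simp
  qed
  have m_other: "m u v w = 0 \<or> m u v w = 3"
    if "u \<in> V" "v \<in> V" "w \<in> V" "distinct [u, v, w]" "\<tau> {u, v, w} \<noteq> 1" for u v w
  proof -
    have e: "{u, w, v} = {u, v, w}" "{v, w, u} = {u, v, w}" by auto
    have "\<tau> {u, v, w} = 0 \<or> \<tau> {u, v, w} = 2" using tau3[of u v w] that by auto
    thus ?thesis
    proof
      assume "\<tau> {u, v, w} = 0"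
      hence "R u v" "R u w" "R v w"
        using lam_pos[of u v w] lam_pos[of u w v] lam_pos[of v w u] that unfolding R_def e by auto
      thus ?thesis by (simp add: m_def)
    next
      assume "\<tau> {u, v, w} = 2"
      hence "\<not> R u v" "\<not> R u w" "\<not> R v w"
        using lam_zero[of u v w] lam_zero[of u w v] lam_zero[of v w u] that unfolding R_def e by auto
      thus ?thesis by (simp add: m_def)
    qed
  qed
  \<comment> \<open>Chosen so that a 3-set of type 1 has exactly one E-pair in both cases of
    \<open>m0\<close>. The other 3-sets have none or three, so two never occur and E is transitive
    on distinct points.\<close>
  define E where "E u v = (if m0 = 1 then R u v else \<not> R u v)" for u v
  have R_sym: "R u v \<longleftrightarrow> R v u" for u v by (simp add: R_def pair_degree_commute)
  have E_sym: "E u v \<longleftrightarrow> E v u" for u v using R_sym by (simp add: E_def)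
  have E1: "\<tau> {u, v, w} = 1" if "u \<in> V" "v \<in> V" "w \<in> V" "distinct [u, v, w]" "E u v" "\<not> E u w" for u v w
  proof (rule ccontr)
    assume "\<tau> {u, v, w} \<noteq> 1"
    from m_other[OF that(1-4) this] show False using that(5,6) m0
      by (cases "R u v"; cases "R u w"; cases "R v w") (auto simp: E_def m_def)
  qed
  have E_trans: "E v w" if "u \<in> V" "v \<in> V" "w \<in> V" "distinct [u, v, w]" "E u v" "E u w" for u v w
  proof -
    have "m u v w = m0 \<or> m u v w = 0 \<or> m u v w = 3"
      using m_other[OF that(1-4)] m1[OF that(1-4)] by blast
    thus ?thesis using that(5,6) m0
      by (cases "R u v"; cases "R u w"; cases "R v w") (auto simp: E_def m_def)
  qed
  have degR: "s0 * int (card {v \<in> V - {u}. R u v}) = K" if "u \<in> V" for u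
  proof -
    have "K = (\<Sum>v\<in>V - {u}. if R u v then s0 else 0)"
      unfolding lam_sum[OF that, symmetric] by (rule sum.cong) (use lamR that in auto)
    thus ?thesis using fin by (subst (asm) sum_if_const) auto
  qed
  have deg_eq: "card {v \<in> V - {u}. R u v} = card {v \<in> V - {w}. R w v}" if "u \<in> V" "w \<in> V" for u w
  proof -
    have "s0 * int (card {v \<in> V - {u}. R u v}) = s0 * int (card {v \<in> V - {w}. R w v})"
      using degR[OF that(1)] degR[OF that(2)] by presburger
    thus ?thesis using s0 by simp
  qed
  have R_nbr: "\<exists>v\<in>V - {u}. R u v" if "u \<in> V" for u
  proof (rule ccontr)
    assume "\<not> ?thesis"
    hence e: "{v \<in> V - {u}. R u v} = {}" by blast
    show False using degR[OF that] Kpos unfolding e by simp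
  qed
  \<comment> \<open>All R-degrees are equal and p', q' is not an R-pair, so no point is R-joined to
    all others.\<close>
  have nR_nbr: "\<exists>v\<in>V - {u}. \<not> R u v" if "u \<in> V" for u
  proof (rule ccontr)
    assume "\<not> ?thesis"
    hence "{v \<in> V - {u}. R u v} = V - {u}" by blast
    hence "card {v \<in> V - {p'}. R p' v} = card (V - {p'})"
      using deg_eq[OF that pqs'(1)] that pqs'(1) fin by simp
    hence "{v \<in> V - {p'}. R p' v} = V - {p'}" using fin by (intro card_subset_eq) auto
    hence "R p' q'" using pqs' by auto
    thus False using lampq' by (simp add: R_def)
  qed
  have E_nbr: "\<exists>v\<in>V - {u}. E u v" if "u \<in> V" for u
    using R_nbr[OF that] nR_nbr[OF that] by (auto simp: E_def)
  obtain x y where xy: "x \<in> V" "y \<in> V" "x \<noteq> y" "\<not> E x y"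
    using R_nbr[OF pqs(1)] nR_nbr[OF pqs(1)] pqs(1) unfolding E_def
    by (metis Diff_iff insertI1)
  obtain x' where x': "x' \<in> V" "x' \<noteq> x" "E x x'" using E_nbr[OF xy(1)] by auto
  obtain y' where y': "y' \<in> V" "y' \<noteq> y" "E y y'" using E_nbr[OF xy(2)] by auto
  have "x' \<noteq> y" "y' \<noteq> x" using xy x' y' E_sym by auto
  moreover have "x' \<noteq> y'" using E_trans[of x' x y] xy x' y' E_sym by auto
  ultimately have dist: "distinct [x, x', y, y']" using xy x' y' by auto
  have n1: "\<not> E x y'" using E_trans[of y' x y] xy x' y' E_sym dist by auto
  have n2: "\<not> E x' y" using E_trans[of x' x y] xy x' y' E_sym dist by auto
  have "\<not> E y x" "\<not> E y x'" using xy n2 E_sym by auto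
  hence one: "\<tau> {x, x', y} = 1" "\<tau> {x, x', y'} = 1" "\<tau> {y, y', x} = 1" "\<tau> {y, y', x'} = 1"
    using E1[of x x' y] E1[of x x' y'] E1[of y y' x] E1[of y y' x'] n1 xy x' y' dist by auto
  \<comment> \<open>Each 3-subset of X has exactly one E-pair, x, x' or y, y', and hence type 1. So
    X would require k 1 = 4 in layer 1 or k 2 = 0 in layer 2.\<close>
  define X where "X = {x, x', y, y'}"
  have X: "X \<subseteq> V" "card X = 4" using xy x' y' dist by (auto simp: X_def)
  have e4: "X - {y'} = {x, x', y}" "X - {y} = {x, x', y'}" "X - {x'} = {y, y', x}" "X - {x} = {y, y', x'}"
    using dist by (auto simp: X_def)
  have tauX: "\<tau> (X - {v}) = 1" if "v \<in> X" for v
  proof -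
    have "v = x \<or> v = x' \<or> v = y \<or> v = y'" using that by (simp add: X_def)
    thus ?thesis by (elim disjE) (simp_all only: e4 one)
  qed
  have "y \<in> X" by (simp add: X_def)
  hence "d X = 1 \<or> d X = 2" using up_remove[OF X, of y] tauX by auto
  thus False
  proof
    assume "d X = 1"
    hence "{v \<in> X. \<tau> (X - {v}) = d X} = X" using tauX by auto
    thus False using sub[OF X] X k_bounds[of 1] rho \<open>d X = 1\<close> by simp
  next
    assume "d X = 2"
    hence e: "{v \<in> X. \<tau> (X - {v}) = d X} = {}" using tauX by auto
    show False using sub[OF X] k_bounds[of 2] rho \<open>d X = 2\<close> unfolding e by simp
  qed
qed

end

section \<open>Johnson graphs and distance layers\<close>

lemma johnson_vertsD:
  assumes "x \<in> johnson_verts n w"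
  shows "x \<subseteq> {1..n}" "card x = w" "finite x"
  using assms finite_subset[of x "{1..n}"] by (auto simp: johnson_verts_def)

lemma finite_johnson_verts: "finite (johnson_verts n w)"
  by (rule finite_subset[of _ "Pow {1..n}"]) (auto simp: johnson_verts_def)

lemma johnson_edges_sym: "(x, y) \<in> johnson_edges n w \<Longrightarrow> (y, x) \<in> johnson_edges n w"
  by (auto simp: johnson_edges_def Int_commute)

lemma exchange_edge:
  assumes x: "x \<in> johnson_verts n w" and v: "v \<in> x" and u: "u \<in> {1..n} - x"
  shows "(x, insert u (x - {v})) \<in> johnson_edges n w"
proof -
  note X = johnson_vertsD[OF x]
  have c: "Suc (card (x - {v})) = w" using card_Suc_Diff1[OF X(3) v] unfolding X(2) .
  moreover have "card (insert u (x - {v})) = Suc (card (x - {v}))"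
    by (rule card_insert_disjoint) (use X u in auto)
  moreover have "insert u (x - {v}) \<subseteq> {1..n}" using X u by auto
  moreover have "x \<inter> insert u (x - {v}) = x - {v}" using v u by auto
  ultimately show ?thesis using x by (auto simp: johnson_edges_def johnson_verts_def)
qed

lemma edge_exchange:
  assumes "(x, y) \<in> johnson_edges n w"
  obtains v u where "v \<in> x" "u \<in> {1..n} - x" "y = insert u (x - {v})"
proof -
  have x: "x \<in> johnson_verts n w" and y: "y \<in> johnson_verts n w" and c: "Suc (card (x \<inter> y)) = w"
    using assms by (auto simp: johnson_edges_def)
  note X = johnson_vertsD[OF x] and Y = johnson_vertsD[OF y]
  have "card (x - y) = card x - card (x \<inter> y)"
    using X by (metis Diff_Int2 Int_lower1 Int_commute card_Diff_subset_Int finite_Int)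
  hence "card (x - y) = 1" using X c by simp
  then obtain v where v: "x - y = {v}" by (auto simp: card_1_singleton_iff)
  have "card (y - x) = card y - card (x \<inter> y)"
    using Y by (metis Int_commute card_Diff_subset_Int finite_Int)
  hence "card (y - x) = 1" using Y c by simp
  then obtain u where u: "y - x = {u}" by (auto simp: card_1_singleton_iff)
  have "v \<in> x" "u \<in> {1..n} - x" "y = insert u (x - {v})" using u v Y(1) by auto
  thus ?thesis by (rule that)
qed

lemma sum_johnson_nbrs:
  assumes x: "x \<in> johnson_verts n w"
  shows "(\<Sum>y | (x, y) \<in> johnson_edges n w. g y) = (\<Sum>v\<in>x. \<Sum>u\<in>{1..n} - x. g (insert u (x - {v})))"
proof -
  have "(\<Sum>y | (x, y) \<in> johnson_edges n w. g y) = (\<Sum>(v, u)\<in>x \<times> ({1..n} - x). g (insert u (x - {v})))"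
  proof (rule sum.reindex_cong[where l = "\<lambda>(v, u). insert u (x - {v})"])
    show "inj_on (\<lambda>(v, u). insert u (x - {v})) (x \<times> ({1..n} - x))"
    proof (rule inj_onI, clarify)
      fix v u v' u' assume *: "v \<in> x" "v' \<in> x" "u \<in> {1..n}" "u \<notin> x" "u' \<in> {1..n}" "u' \<notin> x"
        "insert u (x - {v}) = insert u' (x - {v'})"
      have "{v} = x - insert u (x - {v})" "{v'} = x - insert u' (x - {v'})"
        "{u} = insert u (x - {v}) - x" "{u'} = insert u' (x - {v'}) - x" using * by auto
      thus "v = v' \<and> u = u'" using *(7) by (metis singleton_inject)
    qed
    show "{y. (x, y) \<in> johnson_edges n w} = (\<lambda>(v, u). insert u (x - {v})) ` (x \<times> ({1..n} - x))"
      by (auto simp: exchange_edge[OF x] elim!: edge_exchange)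
  qed auto
  thus ?thesis by (simp add: sum.cartesian_product)
qed

text \<open>Exchanging a point of x - y for one of y - x is an edge that lowers
  \<open>card (x - y)\<close> by one. The existence of a path also gives the \<open>LEAST\<close> in
  \<open>johnson_dist\<close> its meaning.\<close>

lemma johnson_path:
  assumes "x \<in> johnson_verts n w" "y \<in> johnson_verts n w"
  shows "(x, y) \<in> johnson_edges n w ^^ card (x - y)"
  using assms(1)
proof (induction "card (x - y)" arbitrary: x)
  case 0
  hence "x \<subseteq> y" using johnson_vertsD[OF \<open>x \<in> _\<close>] by auto
  hence "x = y" using johnson_vertsD[OF \<open>x \<in> _\<close>] johnson_vertsD[OF assms(2)] by (metis card_subset_eq)
  thus ?case by simp
next
  case (Suc m)
  note X = johnson_vertsD[OF \<open>x \<in> _\<close>] and Y = johnson_vertsD[OF assms(2)]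
  have "x - y \<noteq> {}" using Suc(2) by (metis card.empty nat.distinct(1))
  then obtain v where v: "v \<in> x" "v \<notin> y" by auto
  have "y - x \<noteq> {}"
  proof
    assume "y - x = {}"
    hence "y = x" using X Y by (intro card_subset_eq) auto
    thus False using v by simp
  qed
  then obtain u where u: "u \<in> y" "u \<notin> x" by auto
  define z where "z = insert u (x - {v})"
  have e: "(x, z) \<in> johnson_edges n w" unfolding z_def using exchange_edge[OF Suc(3)] v u Y by auto
  have "z - y = (x - y) - {v}" using u v by (auto simp: z_def)
  hence "m = card (z - y)" using Suc(2) v X by simp
  hence "(z, y) \<in> johnson_edges n w ^^ m" using Suc(1)[of z] e by (auto simp: johnson_edges_def)
  hence "(x, y) \<in> johnson_edges n w ^^ Suc m" using e by (rule relpow_Suc_I2[rotated])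
  thus ?case unfolding Suc(2)[symmetric] .
qed

lemma johnson_dist_path:
  assumes "x \<in> johnson_verts n w" "y \<in> johnson_verts n w"
  shows "(x, y) \<in> johnson_edges n w ^^ johnson_dist n w x y"
  unfolding johnson_dist_def using johnson_path[OF assms] by (rule LeastI)

lemma johnson_dist_le: "(x, y) \<in> johnson_edges n w ^^ k \<Longrightarrow> johnson_dist n w x y \<le> k"
  unfolding johnson_dist_def by (rule Least_le)

section \<open>The distance from a code\<close>

context
  fixes n w :: nat and C :: "nat set set"
  assumes C: "is_code n w C"
begin

lemma code_verts: "c \<in> C \<Longrightarrow> c \<in> johnson_verts n w"
  using C by (auto simp: is_code_def)

lemma code_dist_attained: "\<exists>c\<in>C. code_dist n w C x = johnson_dist n w x c"
proof -
  have "Inf ((\<lambda>c. johnson_dist n w x c) ` C) \<in> (\<lambda>c. johnson_dist n w x c) ` C"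
    using C by (intro Inf_nat_def1) (auto simp: is_code_def)
  thus ?thesis by (auto simp: code_dist_def)
qed

lemma code_dist_le: "c \<in> C \<Longrightarrow> code_dist n w C x \<le> johnson_dist n w x c"
  unfolding code_dist_def by (rule cINF_lower) auto

lemma code_dist_edge:
  assumes "(x, y) \<in> johnson_edges n w"
  shows "code_dist n w C x \<le> Suc (code_dist n w C y)"
proof -
  obtain c where c: "c \<in> C" "code_dist n w C y = johnson_dist n w y c"
    using code_dist_attained by blast
  have "y \<in> johnson_verts n w" using assms by (auto simp: johnson_edges_def)
  hence "(x, c) \<in> johnson_edges n w ^^ Suc (johnson_dist n w y c)"
    using johnson_dist_path code_verts[OF c(1)] assms by (intro relpow_Suc_I2) auto
  thus ?thesis using code_dist_le[OF c(1), of x] johnson_dist_le c(2) by fastforce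
qed

lemma code_dist_0:
  assumes "x \<in> johnson_verts n w"
  shows "code_dist n w C x = 0 \<longleftrightarrow> x \<in> C"
proof
  assume "code_dist n w C x = 0"
  then obtain c where "c \<in> C" "johnson_dist n w x c = 0" using code_dist_attained[of x] by auto
  thus "x \<in> C" using johnson_dist_path[OF assms code_verts, of c] by auto
next
  assume "x \<in> C"
  thus "code_dist n w C x = 0" using code_dist_le[of x x] johnson_dist_le[where k = 0 and x = x and y = x] by auto
qed

lemma code_dist_step:
  assumes "x \<in> johnson_verts n w" "code_dist n w C x = Suc i"
  obtains y where "(x, y) \<in> johnson_edges n w" "code_dist n w C y = i"
proof -
  obtain c where c: "c \<in> C" "johnson_dist n w x c = Suc i" using code_dist_attained[of x] assms by auto
  have "(x, c) \<in> johnson_edges n w ^^ Suc i"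
    using johnson_dist_path[OF assms(1) code_verts[OF c(1)]] c(2) by simp
  then obtain y where y: "(x, y) \<in> johnson_edges n w" "(y, c) \<in> johnson_edges n w ^^ i"
    by (elim relpow_Suc_E2)
  have "code_dist n w C y \<le> i" using code_dist_le[OF c(1), of y] johnson_dist_le[OF y(2)] by simp
  moreover have "Suc i \<le> Suc (code_dist n w C y)" using code_dist_edge[OF y(1)] assms by simp
  ultimately show ?thesis using that[of y] y by simp
qed

lemma code_dist_le_card:
  assumes "x \<in> johnson_verts n w" "c \<in> C"
  shows "code_dist n w C x \<le> card (x - c)"
  using code_dist_le[OF assms(2), of x] johnson_dist_le[OF johnson_path[OF assms(1) code_verts[OF assms(2)]]]
  by simp

lemma finite_code_layers: "finite {i. code_layer n w C i \<noteq> {}}"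
  by (rule finite_subset[of _ "code_dist n w C ` johnson_verts n w"])
    (auto simp: code_layer_def finite_johnson_verts)

lemma code_layers_nonempty: "{i. code_layer n w C i \<noteq> {}} \<noteq> {}"
proof -
  obtain c where "c \<in> C" using C by (auto simp: is_code_def)
  hence "c \<in> code_layer n w C (code_dist n w C c)" using code_verts by (auto simp: code_layer_def)
  thus ?thesis by blast
qed

lemma code_dist_le_radius:
  assumes "x \<in> johnson_verts n w"
  shows "code_dist n w C x \<le> covering_radius n w C"
  unfolding covering_radius_def
  by (rule Max_ge[OF finite_code_layers]) (use assms in \<open>auto simp: code_layer_def\<close>)

text \<open>Downward induction from the covering radius: a vertex at distance i + 1 has a neighbour
  at distance i.\<close>

lemma layer_nonempty:
  assumes "i \<le> covering_radius n w C"
  shows "\<exists>x\<in>johnson_verts n w. code_dist n w C x = i"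
  using assms
proof (induction rule: inc_induct)
  case base
  have "covering_radius n w C \<in> {i. code_layer n w C i \<noteq> {}}"
    unfolding covering_radius_def by (rule Max_in[OF finite_code_layers code_layers_nonempty])
  thus ?case by (auto simp: code_layer_def)
next
  case (step i)
  then obtain x where x: "x \<in> johnson_verts n w" "code_dist n w C x = Suc i" by blast
  then obtain y where "(x, y) \<in> johnson_edges n w" "code_dist n w C y = i" by (rule code_dist_step)
  thus ?case by (auto simp: johnson_edges_def)
qed

end

section \<open>The eigenspace of the least eigenvalue\<close>

text \<open>Both sides run over the flags consisting of an m-set inside an (m + 1)-set.\<close>

lemma sum_exchange:
  fixes g :: "'a set \<Rightarrow> 'a set \<Rightarrow> 'b::comm_monoid_add"
  assumes "finite V"
  shows "(\<Sum>T | T \<subseteq> V \<and> card T = m. \<Sum>u\<in>V - T. g T (insert u T)) =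
    (\<Sum>x | x \<subseteq> V \<and> card x = Suc m. \<Sum>v\<in>x. g (x - {v}) x)"
proof -
  have fin: "finite x" if "x \<subseteq> V" for x using that assms finite_subset by blast
  have "(\<Sum>T | T \<subseteq> V \<and> card T = m. \<Sum>u\<in>V - T. g T (insert u T)) =
    (\<Sum>(T, u)\<in>(SIGMA T:{T. T \<subseteq> V \<and> card T = m}. V - T). g T (insert u T))"
    using assms by (subst sum.Sigma) auto
  also have "\<dots> = (\<Sum>(x, v)\<in>(SIGMA x:{x. x \<subseteq> V \<and> card x = Suc m}. x). g (x - {v}) x)"
    by (rule sum.reindex_bij_witness[of _ "\<lambda>(x, v). (x - {v}, v)" "\<lambda>(T, u). (insert u T, u)"])
      (auto simp: fin insert_absorb)
  also have "\<dots> = (\<Sum>x | x \<subseteq> V \<and> card x = Suc m. \<Sum>v\<in>x. g (x - {v}) x)"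
    using assms fin by (subst sum.Sigma) auto
  finally show ?thesis .
qed

locale min_eigenvalue_code =
  fixes n :: nat and C :: "nat set set"
  assumes n: "8 \<le> n" and cr: "completely_regular n 4 C"
    and ev: "johnson_eigenvalue n 4 4 \<in> code_spec n 4 C"
begin

abbreviation "V \<equiv> {1..n}"
abbreviation "X \<equiv> johnson_verts n 4"
abbreviation "E \<equiv> johnson_edges n 4"
abbreviation "d \<equiv> code_dist n 4 C"
abbreviation "\<rho> \<equiv> covering_radius n 4 C"

lemma code: "is_code n 4 C" using cr by (simp add: completely_regular_def)

lemmas d_edge = code_dist_edge[OF code]
lemmas d_step = code_dist_step[OF code]
lemmas d_le = code_dist_le_radius[OF code]
lemmas layer = layer_nonempty[OF code]

lemma X_eq: "X = {x. x \<subseteq> V \<and> card x = 4}" by (simp add: johnson_verts_def)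

lemma insert_X: "T \<subseteq> V \<Longrightarrow> card T = 3 \<Longrightarrow> v \<in> V - T \<Longrightarrow> insert v T \<in> X"
  using finite_subset[of T V] by (auto simp: X_eq)

lemma clique_edge:
  assumes "T \<subseteq> V" "card T = 3" "u \<in> V - T" "v \<in> V - T" "u \<noteq> v"
  shows "(insert u T, insert v T) \<in> E"
proof -
  have "insert v (insert u T - {u}) = insert v T" using assms by auto
  thus ?thesis using exchange_edge[OF insert_X[OF assms(1-3)], of u v] assms by auto
qed

lemma clique_d:
  assumes "T \<subseteq> V" "card T = 3" "u \<in> V - T" "v \<in> V - T"
  shows "d (insert u T) \<le> Suc (d (insert v T))"
  using d_edge[OF clique_edge[OF assms]] by (cases "u = v") auto

lemma layer_nbrs_const:
  assumes "x \<in> X" "y \<in> X" "d x = d y" "i = d x \<or> i = Suc (d x) \<or> Suc i = d x"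
  shows "layer_nbrs n 4 C x i = layer_nbrs n 4 C y i"
proof -
  obtain \<alpha> \<beta> \<gamma> where *: "\<And>i x. i \<le> \<rho> \<Longrightarrow> x \<in> code_layer n 4 C i \<Longrightarrow>
        layer_nbrs n 4 C x i = \<alpha> i \<and> layer_nbrs n 4 C x (Suc i) = \<beta> i \<and>
        (0 < i \<longrightarrow> layer_nbrs n 4 C x (i - 1) = \<gamma> i)"
    using cr unfolding completely_regular_def by blast
  have l: "x \<in> code_layer n 4 C (d x)" "y \<in> code_layer n 4 C (d x)"
    using assms by (auto simp: code_layer_def)
  consider "i = d x" | "i = Suc (d x)" | "0 < d x" "i = d x - 1" using assms(4) by fastforce
  thus ?thesis
    by cases (use *[OF d_le[OF assms(1)] l(1)] *[OF d_le[OF assms(1)] l(2)] in simp_all)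
qed

lemma layer_nbrs_far:
  assumes "x \<in> X" "\<not> (i = d x \<or> i = Suc (d x) \<or> Suc i = d x)"
  shows "layer_nbrs n 4 C x i = 0"
proof -
  have "d y \<noteq> i" if "(x, y) \<in> E" for y
    using d_edge[OF that] d_edge[OF johnson_edges_sym[OF that]] assms by auto
  hence "{y \<in> code_layer n 4 C i. (x, y) \<in> E} = {}" by (auto simp: code_layer_def)
  thus ?thesis unfolding layer_nbrs_def by (metis card.empty)
qed

text \<open>Complete regularity makes the \<open>THE\<close> in \<open>intersection_number\<close>
  well defined. Distances of adjacent vertices differ by at most one, so the entries set to 0 off
  the three diagonals are neighbour counts too.\<close>

lemma intersection_matrix_entry:
  assumes x: "x \<in> X" and i: "i \<le> \<rho>"
  shows "intersection_matrix n 4 C $$ (d x, i) = of_nat (layer_nbrs n 4 C x i)"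
proof (cases "i = d x \<or> i = Suc (d x) \<or> Suc i = d x")
  case True
  have "intersection_number n 4 C (d x) i = layer_nbrs n 4 C x i"
    unfolding intersection_number_def
  proof (rule the_equality)
    show "\<forall>y\<in>code_layer n 4 C (d x). layer_nbrs n 4 C y i = layer_nbrs n 4 C x i"
    proof
      fix y assume "y \<in> code_layer n 4 C (d x)"
      hence "y \<in> X" "d x = d y" by (auto simp: code_layer_def)
      from layer_nbrs_const[OF x this True] show "layer_nbrs n 4 C y i = layer_nbrs n 4 C x i" by simp
    qed
    show "m = layer_nbrs n 4 C x i" if "\<forall>y\<in>code_layer n 4 C (d x). layer_nbrs n 4 C y i = m" for m
      using that x by (auto simp: code_layer_def)
  qed
  thus ?thesis using True i d_le[OF x] by (auto simp: intersection_matrix_def)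
next
  case False
  thus ?thesis using layer_nbrs_far[OF x False] i d_le[OF x] by (auto simp: intersection_matrix_def)
qed

lemma finite_nbrs: "finite {y. (x, y) \<in> E}"
  by (rule finite_subset[OF _ finite_johnson_verts[of n 4]]) (auto simp: johnson_edges_def)

lemma sum_nbrs_layers:
  fixes u :: "nat \<Rightarrow> complex"
  shows "(\<Sum>y | (x, y) \<in> E. u (d y)) = (\<Sum>i\<le>\<rho>. of_nat (layer_nbrs n 4 C x i) * u i)"
proof -
  have "(\<Sum>y | (x, y) \<in> E. u (d y)) = (\<Sum>i\<le>\<rho>. \<Sum>y | (x, y) \<in> E \<and> d y = i. u (d y))"
    by (subst sum.group[symmetric, of "{y. (x, y) \<in> E}" "{..\<rho>}" d])
      (use finite_nbrs d_le in \<open>auto simp: johnson_edges_def\<close>)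
  also have "\<dots> = (\<Sum>i\<le>\<rho>. of_nat (layer_nbrs n 4 C x i) * u i)"
  proof (rule sum.cong[OF refl])
    fix i
    have "{y. (x, y) \<in> E \<and> d y = i} = {y \<in> code_layer n 4 C i. (x, y) \<in> E}"
      by (auto simp: code_layer_def johnson_edges_def)
    hence "layer_nbrs n 4 C x i = card {y. (x, y) \<in> E \<and> d y = i}" by (simp add: layer_nbrs_def)
    thus "(\<Sum>y | (x, y) \<in> E \<and> d y = i. u (d y)) = of_nat (layer_nbrs n 4 C x i) * u i" by simp
  qed
  finally show ?thesis .
qed

text \<open>Every row index up to \<open>\<rho>\<close> is \<open>d x\<close> for some vertex x, so
  the matrix equation can be tested at vertices; u is a total function, hence non-vanishing is asked
  only up to \<open>\<rho>\<close>.\<close>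

lemma eigenvalue_iff:
  "\<theta> \<in> code_spec n 4 C \<longleftrightarrow> (\<exists>u. (\<exists>i\<le>\<rho>. u i \<noteq> 0) \<and>
     (\<forall>x\<in>X. (\<Sum>i\<le>\<rho>. of_nat (layer_nbrs n 4 C x i) * u i) = \<theta> * u (d x)))"
proof -
  let ?M = "intersection_matrix n 4 C"
  have dim: "dim_row ?M = Suc \<rho>" "dim_col ?M = Suc \<rho>" by (auto simp: intersection_matrix_def)
  have mult: "(?M *\<^sub>v vec (Suc \<rho>) u) $ (d x) = (\<Sum>i\<le>\<rho>. of_nat (layer_nbrs n 4 C x i) * u i)"
    if "x \<in> X" for x u
  proof -
    have "(?M *\<^sub>v vec (Suc \<rho>) u) $ (d x) = (\<Sum>i = 0..<Suc \<rho>. ?M $$ (d x, i) * u i)"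
      using d_le[OF that] dim by (simp add: scalar_prod_def)
    also have "\<dots> = (\<Sum>i\<le>\<rho>. of_nat (layer_nbrs n 4 C x i) * u i)"
      by (rule sum.cong) (use intersection_matrix_entry[OF that] in auto)
    finally show ?thesis .
  qed
  have "\<theta> \<in> code_spec n 4 C \<longleftrightarrow>
    (\<exists>v. v \<in> carrier_vec (Suc \<rho>) \<and> v \<noteq> 0\<^sub>v (Suc \<rho>) \<and> ?M *\<^sub>v v = \<theta> \<cdot>\<^sub>v v)"
    by (simp add: code_spec_def spectrum_def eigenvalue_def eigenvector_def dim)
  also have "\<dots> \<longleftrightarrow> (\<exists>u. vec (Suc \<rho>) u \<noteq> 0\<^sub>v (Suc \<rho>) \<and> ?M *\<^sub>v vec (Suc \<rho>) u = \<theta> \<cdot>\<^sub>v vec (Suc \<rho>) u)"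
  proof
    assume "\<exists>v. v \<in> carrier_vec (Suc \<rho>) \<and> v \<noteq> 0\<^sub>v (Suc \<rho>) \<and> ?M *\<^sub>v v = \<theta> \<cdot>\<^sub>v v"
    then obtain v where v: "v \<in> carrier_vec (Suc \<rho>)" "v \<noteq> 0\<^sub>v (Suc \<rho>)" "?M *\<^sub>v v = \<theta> \<cdot>\<^sub>v v" by blast
    have "v = vec (Suc \<rho>) (\<lambda>i. v $ i)" using v(1) by auto
    thus "\<exists>u. vec (Suc \<rho>) u \<noteq> 0\<^sub>v (Suc \<rho>) \<and> ?M *\<^sub>v vec (Suc \<rho>) u = \<theta> \<cdot>\<^sub>v vec (Suc \<rho>) u"
      using v(2,3) by metis
  next
    assume "\<exists>u. vec (Suc \<rho>) u \<noteq> 0\<^sub>v (Suc \<rho>) \<and> ?M *\<^sub>v vec (Suc \<rho>) u = \<theta> \<cdot>\<^sub>v vec (Suc \<rho>) u"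
    thus "\<exists>v. v \<in> carrier_vec (Suc \<rho>) \<and> v \<noteq> 0\<^sub>v (Suc \<rho>) \<and> ?M *\<^sub>v v = \<theta> \<cdot>\<^sub>v v"
      using vec_carrier by blast
  qed
  also have "\<dots> \<longleftrightarrow> (\<exists>u. (\<exists>i\<le>\<rho>. u i \<noteq> 0) \<and>
     (\<forall>x\<in>X. (\<Sum>i\<le>\<rho>. of_nat (layer_nbrs n 4 C x i) * u i) = \<theta> * u (d x)))"
  proof (intro ex_cong1 conj_cong)
    fix u :: "nat \<Rightarrow> complex"
    show "vec (Suc \<rho>) u \<noteq> 0\<^sub>v (Suc \<rho>) \<longleftrightarrow> (\<exists>i\<le>\<rho>. u i \<noteq> 0)"
      by (auto simp: vec_eq_iff less_Suc_eq_le)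
    show "(?M *\<^sub>v vec (Suc \<rho>) u = \<theta> \<cdot>\<^sub>v vec (Suc \<rho>) u) \<longleftrightarrow>
      (\<forall>x\<in>X. (\<Sum>i\<le>\<rho>. of_nat (layer_nbrs n 4 C x i) * u i) = \<theta> * u (d x))"
    proof
      assume *: "?M *\<^sub>v vec (Suc \<rho>) u = \<theta> \<cdot>\<^sub>v vec (Suc \<rho>) u"
      show "\<forall>x\<in>X. (\<Sum>i\<le>\<rho>. of_nat (layer_nbrs n 4 C x i) * u i) = \<theta> * u (d x)"
        using mult[of _ u] d_le unfolding * by (fastforce simp: less_Suc_eq_le)
    next
      assume *: "\<forall>x\<in>X. (\<Sum>i\<le>\<rho>. of_nat (layer_nbrs n 4 C x i) * u i) = \<theta> * u (d x)"
      show "?M *\<^sub>v vec (Suc \<rho>) u = \<theta> \<cdot>\<^sub>v vec (Suc \<rho>) u"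
      proof (rule eq_vecI)
        fix i assume "i < dim_vec (\<theta> \<cdot>\<^sub>v vec (Suc \<rho>) u)"
        hence i: "i \<le> \<rho>" by simp
        then obtain x where x: "x \<in> X" "d x = i" using layer by blast
        show "(?M *\<^sub>v vec (Suc \<rho>) u) $ i = (\<theta> \<cdot>\<^sub>v vec (Suc \<rho>) u) $ i"
          using mult[OF x(1), of u] * x i by simp
      qed (simp add: dim)
    qed
  qed
  finally show ?thesis .
qed

text \<open>The quadratic form of A + 4 is the sum of the squared clique sums, so an eigenvector
  for -4 sums to zero over every clique.\<close>

lemma clique_sum_zero:
  fixes f :: "nat set \<Rightarrow> complex"
  assumes f: "\<And>x. x \<in> X \<Longrightarrow> (\<Sum>y | (x, y) \<in> E. f y) = - 4 * f x"
    and T: "T \<subseteq> V" "card T = 3"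
  shows "(\<Sum>v\<in>V - T. f (insert v T)) = 0"
proof -
  define F where "F T = (\<Sum>v\<in>V - T. f (insert v T))" for T
  \<comment> \<open>The vertex x lies in all four cliques over its 3-subsets and each neighbour in
    exactly one, so the sum is 4 * f x plus the sum of f over the neighbours.\<close>
  have 0: "(\<Sum>v\<in>x. F (x - {v})) = 0" if x: "x \<in> X" for x
  proof -
    note x' = johnson_vertsD[OF x]
    have "F (x - {v}) = f x + (\<Sum>u\<in>V - x. f (insert u (x - {v})))" if "v \<in> x" for v
    proof -
      have "V - (x - {v}) = insert v (V - x)" "insert v (x - {v}) = x" using x' that by auto
      thus ?thesis using that unfolding F_def by simp
    qed
    hence "(\<Sum>v\<in>x. F (x - {v})) = 4 * f x + (\<Sum>v\<in>x. \<Sum>u\<in>V - x. f (insert u (x - {v})))"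
      using x' by (simp add: sum.distrib)
    thus ?thesis using f[OF x] sum_johnson_nbrs[OF x, of f] by simp
  qed
  have "of_real (\<Sum>T | T \<subseteq> V \<and> card T = 3. (cmod (F T))\<^sup>2) = (\<Sum>T | T \<subseteq> V \<and> card T = 3. F T * cnj (F T))"
    by (simp only: of_real_sum complex_norm_square)
  also have "\<dots> = (\<Sum>T | T \<subseteq> V \<and> card T = 3. \<Sum>u\<in>V - T. F T * cnj (f (insert u T)))"
    by (simp add: F_def sum_distrib_left)
  also have "\<dots> = (\<Sum>x | x \<subseteq> V \<and> card x = Suc 3. \<Sum>v\<in>x. F (x - {v}) * cnj (f x))"
    by (rule sum_exchange) simp
  also have "\<dots> = 0"
  proof (rule sum.neutral, rule ballI)
    fix x assume "x \<in> {x. x \<subseteq> V \<and> card x = Suc 3}"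
    hence "x \<in> X" by (simp add: X_eq)
    thus "(\<Sum>v\<in>x. F (x - {v}) * cnj (f x)) = 0" using 0 by (simp flip: sum_distrib_right)
  qed
  finally have "(\<Sum>T | T \<subseteq> V \<and> card T = 3. (cmod (F T))\<^sup>2) = 0" by (simp only: of_real_eq_0_iff)
  hence "\<forall>T\<in>{T. T \<subseteq> V \<and> card T = 3}. (cmod (F T))\<^sup>2 = 0"
    by (subst (asm) sum_nonneg_eq_0_iff) (auto intro: finite_subset[of _ "Pow V"])
  thus ?thesis using T by (simp add: F_def)
qed

section \<open>The type of a 3-set and the layers above it\<close>

definition \<tau> :: "nat set \<Rightarrow> nat" where "\<tau> T = Min ((\<lambda>v. d (insert v T)) ` (V - T))"

definition low_count :: "nat set \<Rightarrow> nat" where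
  "low_count T = card {v \<in> V - T. d (insert v T) = \<tau> T}"

lemma card_clique:
  assumes "T \<subseteq> V" "card T = 3"
  shows "card (V - T) = n - 3"
  using assms finite_subset[of T V] by (simp add: card_Diff_subset)

lemma tau_attained:
  assumes "T \<subseteq> V" "card T = 3"
  obtains v where "v \<in> V - T" "d (insert v T) = \<tau> T"
proof -
  have "V - T \<noteq> {}"
  proof
    assume e: "V - T = {}"
    show False using card_clique[OF assms] n unfolding e by simp
  qed
  hence "\<tau> T \<in> (\<lambda>v. d (insert v T)) ` (V - T)" unfolding \<tau>_def by (intro Min_in) auto
  thus ?thesis using that by auto
qed

lemma tau_cases:
  assumes "T \<subseteq> V" "card T = 3" "v \<in> V - T"
  shows "d (insert v T) = \<tau> T \<or> d (insert v T) = Suc (\<tau> T)"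
proof -
  have "\<tau> T \<le> d (insert v T)" unfolding \<tau>_def using assms by (intro Min_le) auto
  moreover obtain w where "w \<in> V - T" "d (insert w T) = \<tau> T" using tau_attained[OF assms(1,2)] .
  ultimately show ?thesis using clique_d[OF assms(1-3), of w] by auto
qed

text \<open>A vertex of layer i + 1 has a neighbour in layer i. The 3-set common to both has
  extensions in both layers, so its minimum is i.\<close>

lemma exists_tau:
  assumes y: "y \<in> X" "d y = Suc i"
  obtains T v w where "T \<subseteq> V" "card T = 3" "\<tau> T = i" "v \<in> V - T" "w \<in> V - T" "d (insert v T) = i"
    "insert w T = y" "(y, insert v T) \<in> E"
proof -
  obtain x where x: "(y, x) \<in> E" "d x = i" using y by (rule d_step)
  obtain w v where wv: "w \<in> y" "v \<in> V - y" "x = insert v (y - {w})" using x(1) by (rule edge_exchange)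
  note y' = johnson_vertsD[OF y(1)]
  define T where "T = y - {w}"
  have T: "T \<subseteq> V" "card T = 3" "v \<in> V - T" "w \<in> V - T" "insert w T = y" "insert v T = x"
    using y' wv by (auto simp: T_def)
  have "\<tau> T = i"
    using tau_cases[OF T(1-3)] tau_cases[OF T(1,2,4)] T(5,6) x y by auto
  thus ?thesis using that[of T v w] T x by auto
qed

lemma n3: "of_nat (n - 3) \<noteq> (0 :: complex)"
  using n by (simp only: of_nat_eq_0_iff)

text \<open>Above a 3-set of type i provided by \<open>exists_tau\<close> both layers occur, so the
  vanishing clique sum relates u i and u (i + 1) with two nonzero coefficients. One zero entry would
  therefore spread to the whole vector.\<close>

lemma clique_eigen:
  obtains u :: "nat \<Rightarrow> complex" where "\<And>i. i \<le> \<rho> \<Longrightarrow> u i \<noteq> 0"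
    "\<And>T. T \<subseteq> V \<Longrightarrow> card T = 3 \<Longrightarrow>
      of_nat (low_count T) * u (\<tau> T) + (of_nat (n - 3) - of_nat (low_count T)) * u (Suc (\<tau> T)) = 0"
proof -
  have "johnson_eigenvalue n 4 4 = - 4" by (simp add: johnson_eigenvalue_def)
  then obtain u :: "nat \<Rightarrow> complex" where u: "\<exists>i\<le>\<rho>. u i \<noteq> 0"
    "\<forall>x\<in>X. (\<Sum>i\<le>\<rho>. of_nat (layer_nbrs n 4 C x i) * u i) = - 4 * u (d x)"
    using ev unfolding eigenvalue_iff by auto
  have F: "of_nat (low_count T) * u (\<tau> T) + (of_nat (n - 3) - of_nat (low_count T)) * u (Suc (\<tau> T)) = 0"
    if T: "T \<subseteq> V" "card T = 3" for T
  proof -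
    have "0 = (\<Sum>v\<in>V - T. u (d (insert v T)))"
      by (rule clique_sum_zero[OF _ T, symmetric]) (use u(2) sum_nbrs_layers in simp)
    also have "\<dots> = (\<Sum>v\<in>V - T. if d (insert v T) = \<tau> T then u (\<tau> T) else u (Suc (\<tau> T)))"
    proof (rule sum.cong[OF refl])
      fix v assume "v \<in> V - T"
      thus "u (d (insert v T)) = (if d (insert v T) = \<tau> T then u (\<tau> T) else u (Suc (\<tau> T)))"
        using tau_cases[OF T, of v] by auto
    qed
    also have "\<dots> = u (\<tau> T) * of_nat (low_count T) + u (Suc (\<tau> T)) * (of_nat (n - 3) - of_nat (low_count T))"
      unfolding low_count_def card_clique[OF T, symmetric] by (rule sum_if_const) simp
    finally show ?thesis by (simp add: mult.commute)
  qed
  have step: "u i = 0 \<longleftrightarrow> u (Suc i) = 0" if "i < \<rho>" for i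
  proof -
    have "Suc i \<le> \<rho>" using that by simp
    then obtain y where y: "y \<in> X" "d y = Suc i" using layer by blast
    obtain T v w where T: "T \<subseteq> V" "card T = 3" "\<tau> T = i" "v \<in> V - T" "w \<in> V - T" "d (insert v T) = i"
      "insert w T = y" using y by (rule exists_tau)
    have "low_count T > 0" unfolding low_count_def using T by (auto simp: card_gt_0_iff)
    moreover have "low_count T < card (V - T)"
      unfolding low_count_def
    proof (rule psubset_card_mono)
      have "w \<notin> {v \<in> V - T. d (insert v T) = \<tau> T}" using T(3,7) y(2) by simp
      thus "{v \<in> V - T. d (insert v T) = \<tau> T} \<subset> V - T" using T(5) by blast
    qed simp
    ultimately have "of_nat (low_count T) \<noteq> (0 :: complex)"
      "of_nat (n - 3) - of_nat (low_count T) \<noteq> (0 :: complex)"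
      unfolding card_clique[OF T(1,2)] right_minus_eq of_nat_eq_iff of_nat_eq_0_iff by auto
    thus ?thesis using F[OF T(1,2)] unfolding T(3)
      by (metis add_0 add_0_right mult_eq_0_iff mult_zero_right)
  qed
  have "u i = 0 \<longleftrightarrow> u 0 = 0" if "i \<le> \<rho>" for i using that by (induction i) (auto simp: step)
  hence "u i \<noteq> 0" if "i \<le> \<rho>" for i using u(1) that by blast
  thus ?thesis using F that by blast
qed

text \<open>If all n - 3 extensions of T lay in one layer, the clique sum would be n - 3 times a
  nonzero entry. So both layers occur, and the upper one is still within the covering
  radius.\<close>

lemma low_count_bounds:
  assumes T: "T \<subseteq> V" "card T = 3"
  shows "1 \<le> low_count T" "low_count T + 4 \<le> n" "\<tau> T < \<rho>"
proof -
  obtain v where v: "v \<in> V - T" "d (insert v T) = \<tau> T" using tau_attained[OF T] .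
  thus 1: "1 \<le> low_count T" unfolding low_count_def by (auto simp: Suc_le_eq card_gt_0_iff)
  have tr: "\<tau> T \<le> \<rho>" using d_le[OF insert_X[OF T v(1)]] v by simp
  obtain u :: "nat \<Rightarrow> complex" where u: "\<And>i. i \<le> \<rho> \<Longrightarrow> u i \<noteq> 0"
    "of_nat (low_count T) * u (\<tau> T) + (of_nat (n - 3) - of_nat (low_count T)) * u (Suc (\<tau> T)) = 0"
    using clique_eigen T by metis
  have "low_count T \<noteq> n - 3"
  proof
    assume "low_count T = n - 3"
    thus False using u(1)[OF tr] u(2) n3 by auto
  qed
  moreover have "low_count T \<le> n - 3"
    unfolding low_count_def card_clique[OF T, symmetric] by (rule card_mono) auto
  ultimately show "low_count T + 4 \<le> n" using n by auto
  show "\<tau> T < \<rho>"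
  proof (rule ccontr)
    assume "\<not> \<tau> T < \<rho>"
    hence "{v \<in> V - T. d (insert v T) = \<tau> T} = V - T"
      using tau_cases[OF T] d_le[OF insert_X[OF T]] by force
    thus False using \<open>low_count T \<noteq> n - 3\<close> card_clique[OF T] by (simp add: low_count_def)
  qed
qed

text \<open>The clique relation is linear in \<open>low_count\<close> with coefficient u t - u (t +
  1) for type t. Equality of these entries would again give (n - 3) * u t = 0, so the type
  determines the solution.\<close>

lemma low_count_const:
  assumes T: "T \<subseteq> V" "card T = 3" and S: "S \<subseteq> V" "card S = 3" and "\<tau> T = \<tau> S"
  shows "low_count T = low_count S"
proof -
  obtain u :: "nat \<Rightarrow> complex" where u: "\<And>i. i \<le> \<rho> \<Longrightarrow> u i \<noteq> 0"
    "of_nat (low_count T) * u (\<tau> T) + (of_nat (n - 3) - of_nat (low_count T)) * u (Suc (\<tau> T)) = 0"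
    "of_nat (low_count S) * u (\<tau> S) + (of_nat (n - 3) - of_nat (low_count S)) * u (Suc (\<tau> S)) = 0"
    using clique_eigen T S by metis
  have ne: "u (\<tau> T) \<noteq> u (Suc (\<tau> T))"
  proof
    assume "u (\<tau> T) = u (Suc (\<tau> T))"
    hence "of_nat (n - 3) * u (\<tau> T) = 0" using u(2) by (simp add: algebra_simps)
    thus False using u(1)[of "\<tau> T"] low_count_bounds(3)[OF T] n3 by auto
  qed
  have "(of_nat (low_count T) - of_nat (low_count S)) * (u (\<tau> T) - u (Suc (\<tau> T))) =
    (of_nat (low_count T) * u (\<tau> T) + (of_nat (n - 3) - of_nat (low_count T)) * u (Suc (\<tau> T))) -
    (of_nat (low_count S) * u (\<tau> T) + (of_nat (n - 3) - of_nat (low_count S)) * u (Suc (\<tau> T)))"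
    by (simp only: ring_distribs) simp
  also have "\<dots> = 0" using u(2,3) unfolding \<open>\<tau> T = \<tau> S\<close> by simp
  finally have "(of_nat (low_count T) - of_nat (low_count S)) * (u (\<tau> T) - u (Suc (\<tau> T))) = 0" .
  thus ?thesis using ne by simp
qed

text \<open>The values a i and, below, k i are meaningful only for i < \<rho> and i \<le> \<rho>, respectively.\<close>

definition a :: "nat \<Rightarrow> nat" where
  "a i = low_count (SOME T. T \<subseteq> V \<and> card T = 3 \<and> \<tau> T = i)"

lemma low_count_eq:
  assumes T: "T \<subseteq> V" "card T = 3"
  shows "low_count T = a (\<tau> T)"
proof -
  have "(SOME S. S \<subseteq> V \<and> card S = 3 \<and> \<tau> S = \<tau> T) \<subseteq> V \<and>
    card (SOME S. S \<subseteq> V \<and> card S = 3 \<and> \<tau> S = \<tau> T) = 3 \<and> \<tau> (SOME S. S \<subseteq> V \<and> card S = 3 \<and> \<tau> S = \<tau> T) = \<tau> T"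
    by (rule someI[of _ T]) (use T in auto)
  thus ?thesis unfolding a_def by (intro low_count_const[OF T]) auto
qed

lemma clique_count:
  assumes T: "T \<subseteq> V" "card T = 3"
  shows "card {v \<in> V - T. d (insert v T) = i} =
    (if i = \<tau> T then a (\<tau> T) else if i = Suc (\<tau> T) then n - 3 - a (\<tau> T) else 0)"
proof -
  have l: "card {v \<in> V - T. d (insert v T) = \<tau> T} = a (\<tau> T)"
    using low_count_eq[OF T] by (simp add: low_count_def)
  consider "i = \<tau> T" | "i = Suc (\<tau> T)" | "i \<noteq> \<tau> T" "i \<noteq> Suc (\<tau> T)" by blast
  thus ?thesis
  proof cases
    case 2
    have e: "{v \<in> V - T. d (insert v T) = i} = (V - T) - {v \<in> V - T. d (insert v T) = \<tau> T}"
      using tau_cases[OF T] 2 by force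
    have "card {v \<in> V - T. d (insert v T) = i} = card (V - T) - card {v \<in> V - T. d (insert v T) = \<tau> T}"
      unfolding e by (rule card_Diff_subset) auto
    thus ?thesis using 2 l card_clique[OF T] by simp
  next
    case 3
    hence e: "{v \<in> V - T. d (insert v T) = i} = {}" using tau_cases[OF T] by auto
    show ?thesis using 3 unfolding e by simp
  qed (use l in simp)
qed

section \<open>The 3-subsets of a vertex, sorted by type\<close>

definition sub_count :: "nat set \<Rightarrow> nat" where "sub_count x = card {v \<in> x. \<tau> (x - {v}) = d x}"

lemma remove_X:
  assumes "x \<in> X" "v \<in> x"
  shows "x - {v} \<subseteq> V" "card (x - {v}) = 3" "v \<in> V - (x - {v})" "insert v (x - {v}) = x"
    "d x = \<tau> (x - {v}) \<or> d x = Suc (\<tau> (x - {v}))"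
proof -
  note x = johnson_vertsD[OF assms(1)]
  show *: "x - {v} \<subseteq> V" "card (x - {v}) = 3" "v \<in> V - (x - {v})" "insert v (x - {v}) = x"
    using x assms by auto
  show "d x = \<tau> (x - {v}) \<or> d x = Suc (\<tau> (x - {v}))" using tau_cases[OF *(1-3)] *(4) by simp
qed

text \<open>The four cliques over the 3-subsets of x cover each neighbour once and x itself four
  times; the latter is the correction on the left.\<close>

lemma layer_nbrs_eq:
  assumes x: "x \<in> X"
  shows "layer_nbrs n 4 C x i + (if d x = i then 4 else 0) =
    (\<Sum>v\<in>x. card {u \<in> V - (x - {v}). d (insert u (x - {v})) = i})"
proof -
  note x' = johnson_vertsD[OF x]
  have "layer_nbrs n 4 C x i = card {y. (x, y) \<in> E \<and> d y = i}"
    unfolding layer_nbrs_def by (rule arg_cong[of _ _ card]) (auto simp: code_layer_def johnson_edges_def)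
  also have "\<dots> = (\<Sum>y | (x, y) \<in> E. if d y = i then 1 else 0)"
    using finite_nbrs[of x] by (subst sum.If_cases) (auto simp: Int_def)
  also have "\<dots> = (\<Sum>v\<in>x. \<Sum>u\<in>V - x. if d (insert u (x - {v})) = i then 1 else 0)"
    by (rule sum_johnson_nbrs[OF x])
  finally have "layer_nbrs n 4 C x i + (if d x = i then 4 else 0) =
    (\<Sum>v\<in>x. \<Sum>u\<in>V - x. if d (insert u (x - {v})) = i then 1 else 0) + (if d x = i then 4 else 0)"
    by simp
  also have "\<dots> =
    (\<Sum>v\<in>x. (\<Sum>u\<in>V - x. if d (insert u (x - {v})) = i then 1 else 0) + (if d x = i then 1 else 0))"
    using x' by (simp add: sum.distrib)
  also have "\<dots> = (\<Sum>v\<in>x. card {u \<in> V - (x - {v}). d (insert u (x - {v})) = i})"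
  proof (rule sum.cong[OF refl])
    fix v assume v: "v \<in> x"
    have e: "V - (x - {v}) = insert v (V - x)" "insert v (x - {v}) = x" using v x' by auto
    have "card {u \<in> V - (x - {v}). d (insert u (x - {v})) = i} =
      (\<Sum>u\<in>V - (x - {v}). if d (insert u (x - {v})) = i then 1 else 0)"
      by (subst sum.If_cases) (auto simp: Int_def intro!: arg_cong[of _ _ card])
    also have "\<dots> = (\<Sum>u\<in>V - x. if d (insert u (x - {v})) = i then 1 else 0) + (if d x = i then 1 else 0)"
      unfolding e(1) using v e(2) by simp
    finally show "(\<Sum>u\<in>V - x. if d (insert u (x - {v})) = i then 1 else 0) + (if d x = i then 1 else 0) =
      card {u \<in> V - (x - {v}). d (insert u (x - {v})) = i}" by simp
  qed
  finally show ?thesis .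
qed

text \<open>Not a metric: the distribution over the layers i of the n - 3 vertices above a 3-set of
  type t, as in \<open>clique_count\<close>.\<close>

definition clique_dist :: "nat \<Rightarrow> nat \<Rightarrow> nat" where
  "clique_dist t i = (if i = t then a t else if i = Suc t then n - 3 - a t else 0)"

text \<open>The truncated \<open>d x - 1\<close> is harmless at \<open>d x = 0\<close>: there all
  four 3-subsets have type 0 and the second summand has factor 0.\<close>

lemma layer_nbrs_sub_count:
  assumes x: "x \<in> X"
  shows "layer_nbrs n 4 C x i + (if d x = i then 4 else 0) =
    sub_count x * clique_dist (d x) i + (4 - sub_count x) * clique_dist (d x - 1) i"
proof -
  note x' = johnson_vertsD[OF x]
  let ?S = "{v \<in> x. \<tau> (x - {v}) = d x}"
  have "(\<Sum>v\<in>x. card {u \<in> V - (x - {v}). d (insert u (x - {v})) = i}) =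
    (\<Sum>v\<in>x. if \<tau> (x - {v}) = d x then clique_dist (d x) i else clique_dist (d x - 1) i)"
  proof (rule sum.cong[OF refl])
    fix v assume v: "v \<in> x"
    show "card {u \<in> V - (x - {v}). d (insert u (x - {v})) = i} =
      (if \<tau> (x - {v}) = d x then clique_dist (d x) i else clique_dist (d x - 1) i)"
      using remove_X(5)[OF x v] clique_count[OF remove_X(1,2)[OF x v], of i]
      by (auto simp: clique_dist_def)
  qed
  also have "\<dots> = card ?S * clique_dist (d x) i + card (x - ?S) * clique_dist (d x - 1) i"
    using x' by (subst sum.If_cases) (auto simp: Int_def set_diff_eq intro!: arg_cong2[of _ _ _ _ "(*)"] arg_cong[of _ _ card])
  also have "card (x - ?S) = 4 - card ?S"
    using x' card_Diff_subset[of ?S x] by simp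
  finally show ?thesis unfolding layer_nbrs_eq[OF x] sub_count_def .
qed

text \<open>Neighbours in the next layer come only from 3-subsets of type \<open>d x\<close>, so
  their constant number is sub_count x times the nonzero n - 3 - a (d x). In layer 0 truncation
  would merge the two summands, and in layer \<open>\<rho>\<close> there is no next layer, so these
  cases are treated directly: the values are 4 and 0.\<close>

lemma sub_count_const:
  assumes x: "x \<in> X" and y: "y \<in> X" and "d x = d y"
  shows "sub_count x = sub_count y"
proof (cases "d x < \<rho>")
  case True
  obtain z where "z \<in> X" "d z = Suc (d x)" using layer[of "Suc (d x)"] True by auto
  then obtain T v w where "T \<subseteq> V" "card T = 3" "\<tau> T = d x" by (rule exists_tau)
  hence a: "a (d x) + 4 \<le> n" using low_count_bounds[of T] low_count_eq[of T] by auto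
  show ?thesis
  proof (cases "d x = 0")
    case True
    have "sub_count z = 4" if "z \<in> X" "d z = 0" for z
    proof -
      have "{v \<in> z. \<tau> (z - {v}) = d z} = z" using remove_X[OF that(1)] that(2) by auto
      thus ?thesis using johnson_vertsD[OF that(1)] by (simp add: sub_count_def)
    qed
    thus ?thesis using True assms by auto
  next
    case False
    have *: "layer_nbrs n 4 C z (Suc (d z)) = sub_count z * (n - 3 - a (d z))" if "z \<in> X" "d z \<noteq> 0" for z
      using layer_nbrs_sub_count[OF that(1), of "Suc (d z)"] that(2)
      by (cases "d z") (simp_all add: clique_dist_def)
    have "sub_count x * (n - 3 - a (d x)) = sub_count y * (n - 3 - a (d x))"
      using *[OF x] *[OF y] layer_nbrs_const[OF x y assms(3), of "Suc (d x)"] assms(3) False by simp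
    thus ?thesis using a by simp
  qed
next
  case False
  have "sub_count z = 0" if "z \<in> X" "d z = d x" for z
  proof -
    have "\<tau> (z - {v}) \<noteq> d z" if "v \<in> z" for v
      using low_count_bounds(3)[OF remove_X(1,2)[OF \<open>z \<in> X\<close> that]] False \<open>d z = d x\<close> by auto
    hence e: "{v \<in> z. \<tau> (z - {v}) = d z} = {}" by auto
    show ?thesis unfolding sub_count_def e by simp
  qed
  thus ?thesis using assms by auto
qed

definition k :: "nat \<Rightarrow> nat" where "k i = sub_count (SOME x. x \<in> X \<and> d x = i)"

lemma sub_count_eq:
  assumes "x \<in> X"
  shows "sub_count x = k (d x)"
proof -
  have "(SOME y. y \<in> X \<and> d y = d x) \<in> X \<and> d (SOME y. y \<in> X \<and> d y = d x) = d x"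
    by (rule someI[of _ x]) (use assms in auto)
  thus ?thesis unfolding k_def by (intro sub_count_const[OF assms]) auto
qed

text \<open>A vertex of layer i with a neighbour in layer i + 1 shares a 3-set of type i with it;
  each vertex of layer i has a neighbour in layer i - 1 and shares a 3-set of type i - 1 with
  it.\<close>

lemma k_bounds:
  assumes "0 < i" "i < \<rho>"
  shows "1 \<le> k i \<and> k i \<le> 3"
proof
  obtain z where "z \<in> X" "d z = Suc i" using layer[of "Suc i"] assms by auto
  then obtain T v w where T: "T \<subseteq> V" "card T = 3" "\<tau> T = i" "v \<in> V - T" "d (insert v T) = i"
    by (rule exists_tau)
  have x: "insert v T \<in> X" by (rule insert_X[OF T(1,2,4)])
  have "insert v T - {v} = T" using T by auto
  hence "v \<in> {w \<in> insert v T. \<tau> (insert v T - {w}) = d (insert v T)}" using T by auto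
  hence "sub_count (insert v T) > 0"
    unfolding sub_count_def using johnson_vertsD(3)[OF x] by (auto simp: card_gt_0_iff)
  thus "1 \<le> k i" using sub_count_eq[OF x] T(5) by simp
  obtain x j where x: "x \<in> X" "d x = Suc j" "i = Suc j" using layer[of i] assms by (cases i) auto
  obtain T v w where T: "T \<subseteq> V" "card T = 3" "\<tau> T = j" "w \<in> V - T" "insert w T = x"
    using x(1,2) by (rule exists_tau)
  have "x - {w} = T" using T by auto
  hence "{v \<in> x. \<tau> (x - {v}) = d x} \<subseteq> T" using T x by auto
  hence "sub_count x \<le> card T" unfolding sub_count_def using T finite_subset[of T V] by (intro card_mono) auto
  thus "k i \<le> 3" using sub_count_eq[OF x(1)] T x by simp
qed

end

section \<open>Recognizing the two types of codes\<close>

lemma type_GP3'I: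
  assumes "Y1 \<union> Y2 = {1..n}" "Y1 \<inter> Y2 = {}" "card Y1 = card Y2"
    and H: "\<forall>T. T \<subseteq> {1..n} \<longrightarrow> card T = 3 \<longrightarrow> H T \<longleftrightarrow> T \<subseteq> Y1 \<or> T \<subseteq> Y2"
  shows "type_GP3' n {x \<in> johnson_verts n 4. \<forall>v\<in>x. H (x - {v})}"
proof -
  have "card Y1 + card Y2 = n"
    using card_Un_disjoint[of Y1 Y2] assms(1,2) by (metis card_atLeastAtMost diff_Suc_1 finite_Un finite_atLeastAtMost)
  hence c: "2 * card Y1 = n" "2 * card Y2 = n" using assms(3) by auto
  have "(\<forall>v\<in>x. H (x - {v})) \<longleftrightarrow> x \<subseteq> Y1 \<or> x \<subseteq> Y2" if x: "x \<in> johnson_verts n 4" for x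
  proof -
    note x' = johnson_vertsD[OF x]
    have H': "H (x - {v}) \<longleftrightarrow> x - {v} \<subseteq> Y1 \<or> x - {v} \<subseteq> Y2" if "v \<in> x" for v
      by (rule H[rule_format]) (use x' that in auto)
    show ?thesis
    proof
      assume all: "\<forall>v\<in>x. H (x - {v})"
      show "x \<subseteq> Y1 \<or> x \<subseteq> Y2"
      proof (rule ccontr)
        assume "\<not> ?thesis"
        then obtain p q where pq: "p \<in> x" "q \<in> x" "p \<notin> Y1" "q \<notin> Y2" by blast
        have "p \<noteq> q" using pq x' assms(1) by auto
        have "\<not> x \<subseteq> {p, q}"
        proof
          assume "x \<subseteq> {p, q}"
          hence "card x \<le> card {p, q}" by (intro card_mono) auto
          thus False using x' card_insert_le_m1[of 2 "{q}" p] by (auto split: if_splits simp: card_insert_if)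
        qed
        \<comment> \<open>Removing r leaves both p, outside Y1, and q, outside Y2.\<close>
        then obtain r where r: "r \<in> x" "r \<noteq> p" "r \<noteq> q" by blast
        show False using all[rule_format, OF r(1)] H'[OF r(1)] pq r by auto
      qed
    qed (use H' in auto)
  qed
  hence "{x \<in> johnson_verts n 4. \<forall>v\<in>x. H (x - {v})} = {x. card x = 4 \<and> (x \<subseteq> Y1 \<or> x \<subseteq> Y2)}"
    using assms(1) by (auto simp: johnson_verts_def)
  thus ?thesis unfolding type_GP3'_def using assms(1,2) c by blast
qed

lemma type_M1_of_blocks:
  assumes part: "\<Union> B = {1..n}" "\<And>p q. p \<in> B \<Longrightarrow> q \<in> B \<Longrightarrow> p \<noteq> q \<Longrightarrow> p \<inter> q = {}"
    and two: "\<And>p. p \<in> B \<Longrightarrow> card p = 2"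
  shows "type_M1 n {p \<union> q | p q. p \<in> B \<and> q \<in> B \<and> p \<noteq> q}"
proof -
  have finB: "finite B" using part(1) by (metis finite_UnionD finite_atLeastAtMost)
  have "2 * card B = card (\<Union> B)"
    by (rule card_partition) (use finB part two in auto)
  hence cB: "n = 2 * card B" using part(1) by simp
  obtain e where e: "bij_betw e {1..card B} B" using ex_bij_betw_nat_finite_1[OF finB] by blast
  have eB: "e i \<in> B" if "1 \<le> i" "i \<le> card B" for i using e that by (auto simp: bij_betw_def)
  \<comment> \<open>The points 2i - 1 and 2i go to the smaller and the larger point of the i-th
    block; (x + 1) div 2 is the index i for x.\<close>
  define \<pi> where "\<pi> x = (if x \<in> {1..n} then if odd x then Min (e ((x + 1) div 2)) else Max (e ((x + 1) div 2)) else x)" for x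
  have image: "\<pi> ` M1_block i = e i" if i: "1 \<le> i" "i \<le> card B" for i
  proof -
    obtain a b where ab: "e i = {a, b}" "a \<noteq> b" using two[OF eB[OF i]] by (auto simp: card_2_iff)
    have "2 * i - 1 \<in> {1..n}" "2 * i \<in> {1..n}" "odd (2 * i - 1)" "(2 * i - 1 + 1) div 2 = i" "(2 * i + 1) div 2 = i"
      using i cB by auto
    hence "\<pi> (2 * i - 1) = Min (e i)" "\<pi> (2 * i) = Max (e i)" unfolding \<pi>_def by simp_all
    thus ?thesis unfolding M1_block_def ab(1) using ab(2) by (auto simp: min_def max_def)
  qed
  have blocks: "{1..n} = (\<Union>i\<in>{1..card B}. M1_block i)"
  proof (intro equalityI subsetI)
    fix x assume "x \<in> {1..n}"
    hence "(x + 1) div 2 \<in> {1..card B}" "x \<in> M1_block ((x + 1) div 2)"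
      unfolding M1_block_def using cB by (auto elim!: evenE oddE)
    thus "x \<in> (\<Union>i\<in>{1..card B}. M1_block i)" by blast
  qed (auto simp: M1_block_def cB)
  have surj: "\<pi> ` {1..n} = {1..n}"
  proof -
    have "\<pi> ` {1..n} = (\<Union>i\<in>{1..card B}. \<pi> ` M1_block i)" unfolding blocks by blast
    also have "\<dots> = (\<Union>i\<in>{1..card B}. e i)" using image by auto
    also have "\<dots> = {1..n}" using e part(1) by (auto simp: bij_betw_def)
    finally show ?thesis .
  qed
  hence "inj_on \<pi> {1..n}" by (intro eq_card_imp_inj_on) auto
  hence perm: "\<pi> permutes {1..n}"
    by (intro bij_imp_permutes) (use surj in \<open>auto simp: bij_betw_def \<pi>_def\<close>)
  define I where "I = {(i, j). i \<in> {1..card B} \<and> j \<in> {1..card B} \<and> i \<noteq> j}"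
  have "M1_code n = (\<lambda>(i, j). M1_block i \<union> M1_block j) ` I"
    unfolding M1_code_def I_def cB by auto
  hence "(\<lambda>x. \<pi> ` x) ` M1_code n = (\<lambda>ij. \<pi> ` (case ij of (i, j) \<Rightarrow> M1_block i \<union> M1_block j)) ` I"
    by (simp only: image_image)
  also have "\<dots> = (\<lambda>(i, j). e i \<union> e j) ` I"
    by (rule image_cong) (use image in \<open>auto simp: image_Un I_def\<close>)
  also have "\<dots> = {p \<union> q | p q. p \<in> B \<and> q \<in> B \<and> p \<noteq> q}"
  proof (intro equalityI subsetI)
    fix x assume "x \<in> (\<lambda>(i, j). e i \<union> e j) ` I"
    then obtain i j where ij: "x = e i \<union> e j" "i \<in> {1..card B}" "j \<in> {1..card B}" "i \<noteq> j"
      unfolding I_def by auto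
    have "e i \<noteq> e j" using e ij(2-4) unfolding bij_betw_def inj_on_def by blast
    moreover have "e i \<in> B" "e j \<in> B" using ij(2,3) eB by auto
    ultimately show "x \<in> {p \<union> q | p q. p \<in> B \<and> q \<in> B \<and> p \<noteq> q}" using ij(1) by blast
  next
    fix x assume "x \<in> {p \<union> q | p q. p \<in> B \<and> q \<in> B \<and> p \<noteq> q}"
    then obtain p q where pq: "x = p \<union> q" "p \<in> B" "q \<in> B" "p \<noteq> q" by auto
    have "e ` {1..card B} = B" using e by (simp add: bij_betw_def)
    hence "p \<in> e ` {1..card B}" "q \<in> e ` {1..card B}" using pq(2,3) by (simp_all only:)
    then obtain i j where "p = e i" "q = e j" "i \<in> {1..card B}" "j \<in> {1..card B}" by blast
    hence "(i, j) \<in> I" "x = (\<lambda>(i, j). e i \<union> e j) (i, j)" using pq by (auto simp: I_def)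
    thus "x \<in> (\<lambda>(i, j). e i \<union> e j) ` I" by (rule rev_image_eqI)
  qed
  finally have eq: "(\<lambda>x. \<pi> ` x) ` M1_code n = {p \<union> q | p q. p \<in> B \<and> q \<in> B \<and> p \<noteq> q}" .
  have "even n" unfolding cB by simp
  thus ?thesis unfolding type_M1_def using perm eq[symmetric] by blast
qed

text \<open>Removing a point a of a pair a, \<open>\<mu> a\<close> from a 4-set with all 3-subsets
  in \<open>H\<close> leaves another pair, disjoint from the first since \<open>\<mu>\<close> is an
  involution. Conversely, removing a point from a union of two pairs leaves one pair intact.\<close>

lemma type_M1I:
  assumes \<mu>: "\<And>a. a \<in> {1..n} \<Longrightarrow> \<mu> a \<in> {1..n} \<and> \<mu> a \<noteq> a \<and> \<mu> (\<mu> a) = a"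
    and H: "\<And>T. T \<subseteq> {1..n} \<Longrightarrow> card T = 3 \<Longrightarrow> H T \<longleftrightarrow> (\<exists>a\<in>T. \<mu> a \<in> T)"
  shows "type_M1 n {x \<in> johnson_verts n 4. \<forall>v\<in>x. H (x - {v})}"
proof -
  define B where "B = (\<lambda>a. {a, \<mu> a}) ` {1..n}"
  have B: "p = {a, \<mu> a}" if "p \<in> B" "a \<in> p" for p a
  proof -
    have "\<exists>b\<in>{1..n}. p = {b, \<mu> b}" using that(1) unfolding B_def by blast
    then obtain b where "b \<in> {1..n}" "p = {b, \<mu> b}" by blast
    thus ?thesis using that(2) \<mu>[of b] by auto
  qed
  have "type_M1 n {p \<union> q | p q. p \<in> B \<and> q \<in> B \<and> p \<noteq> q}"
  proof (rule type_M1_of_blocks)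
    show "\<Union> B = {1..n}" using \<mu> by (auto simp: B_def)
    show "p \<inter> q = {}" if "p \<in> B" "q \<in> B" "p \<noteq> q" for p q
    proof (rule ccontr)
      assume "p \<inter> q \<noteq> {}"
      then obtain a where "a \<in> p" "a \<in> q" by blast
      hence "p = q" using B[OF that(1), of a] B[OF that(2), of a] by simp
      thus False using that by simp
    qed
    show "card p = 2" if "p \<in> B" for p
    proof -
      have "\<exists>a\<in>{1..n}. p = {a, \<mu> a}" using that unfolding B_def by blast
      then obtain a where "a \<in> {1..n}" "p = {a, \<mu> a}" by blast
      moreover have "\<mu> a \<noteq> a" using \<mu> calculation(1) by blast
      ultimately show ?thesis by auto
    qed
  qed
  also have "{p \<union> q | p q. p \<in> B \<and> q \<in> B \<and> p \<noteq> q} = {x \<in> johnson_verts n 4. \<forall>v\<in>x. H (x - {v})}"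
  proof (intro equalityI subsetI)
    fix x assume "x \<in> {p \<union> q | p q. p \<in> B \<and> q \<in> B \<and> p \<noteq> q}"
    then obtain p q where pq: "x = p \<union> q" "p \<in> B" "q \<in> B" "p \<noteq> q" by blast
    obtain a b where ab: "a \<in> {1..n}" "b \<in> {1..n}" "p = {a, \<mu> a}" "q = {b, \<mu> b}"
      using pq(2,3) by (auto simp: B_def)
    have x: "x = {a, \<mu> a, b, \<mu> b}" using pq(1) ab by auto
    have ne: "a \<noteq> \<mu> a" "b \<noteq> \<mu> b" using \<mu> ab by metis+
    have "b \<notin> p" "\<mu> b \<notin> p"
      using B[OF pq(2), of b] B[OF pq(2), of "\<mu> b"] pq(4) ab(4) \<mu>[OF ab(2)] by auto
    hence dist: "distinct [a, \<mu> a, b, \<mu> b]" using ne ab(3) by auto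
    have X: "x \<in> johnson_verts n 4"
      unfolding johnson_verts_def x using dist \<mu>[OF ab(1)] \<mu>[OF ab(2)] ab by simp
    have "H (x - {v})" if "v \<in> x" for v
    proof -
      have "H (x - {v}) \<longleftrightarrow> (\<exists>c\<in>x - {v}. \<mu> c \<in> x - {v})"
        by (rule H) (use johnson_vertsD[OF X] that in auto)
      moreover have "v \<notin> {a, \<mu> a} \<or> v \<notin> {b, \<mu> b}" using dist by auto
      ultimately show ?thesis using x by auto
    qed
    thus "x \<in> {x \<in> johnson_verts n 4. \<forall>v\<in>x. H (x - {v})}" using X by blast
  next
    fix x assume "x \<in> {x \<in> johnson_verts n 4. \<forall>v\<in>x. H (x - {v})}"
    hence X: "x \<in> johnson_verts n 4" and all: "\<And>v. v \<in> x \<Longrightarrow> H (x - {v})" by auto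
    note X' = johnson_vertsD[OF X]
    have pair: "\<exists>c\<in>x - {v}. \<mu> c \<in> x - {v}" if "v \<in> x" for v
    proof -
      have "H (x - {v}) \<longleftrightarrow> (\<exists>c\<in>x - {v}. \<mu> c \<in> x - {v})"
        by (rule H) (use X' that in auto)
      thus ?thesis using all[OF that] by simp
    qed
    have "x \<noteq> {}" using X' by auto
    then obtain v where "v \<in> x" by blast
    then obtain a where a: "a \<in> x" "\<mu> a \<in> x" using pair by blast
    have aV: "a \<in> {1..n}" using a X' by auto
    obtain b where b: "b \<in> x" "\<mu> b \<in> x" "b \<noteq> a" "\<mu> b \<noteq> a" using pair[OF a(1)] by blast
    have bV: "b \<in> {1..n}" using b X' by auto
    have "b \<noteq> \<mu> a" using b(4) \<mu>[OF aV] by auto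
    hence "\<mu> b \<noteq> \<mu> a" using b(3) \<mu>[OF aV] \<mu>[OF bV] by metis
    hence dist: "distinct [a, \<mu> a, b, \<mu> b]" using b \<open>b \<noteq> \<mu> a\<close> \<mu>[OF aV] \<mu>[OF bV] by auto
    hence "card {a, \<mu> a, b, \<mu> b} = card x" using X' by simp
    hence "{a, \<mu> a, b, \<mu> b} = x" using a b X' by (intro card_subset_eq) auto
    hence "x = {a, \<mu> a} \<union> {b, \<mu> b}" by auto
    moreover have "{a, \<mu> a} \<in> B" "{b, \<mu> b} \<in> B" using aV bV by (auto simp: B_def)
    moreover have "{a, \<mu> a} \<noteq> {b, \<mu> b}" using dist by auto
    ultimately show "x \<in> {p \<union> q | p q. p \<in> B \<and> q \<in> B \<and> p \<noteq> q}" by blast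
  qed
  finally show ?thesis .
qed

text \<open>A, B and A', B' stand for the numbers of 4-sets in the lower and upper layer above a
  3-set of type 0 and of type 1; 4 - j is \<open>k 1\<close>, and \<open>rel\<close> is the equation
  \<open>P_eq\<close>.\<close>

lemma tridiagonal_spectrum:
  fixes A B A' B' j N \<theta> :: complex
  assumes AB: "B = N - 3 - A" "B' = N - 3 - A'" and rel: "3 + 3 * A + (j - 1) * B - j * A' = N - 4"
    and nz: "B \<noteq> 0" "B' \<noteq> 0" "4 - j \<noteq> 0"
  shows "(\<exists>u0 u1 u2. (u0 \<noteq> 0 \<or> u1 \<noteq> 0 \<or> u2 \<noteq> 0) \<and>
      (4 * A - 4) * u0 + 4 * B * u1 = \<theta> * u0 \<and>
      j * A * u0 + ((4 - j) * A' + j * B - 4) * u1 + (4 - j) * B' * u2 = \<theta> * u1 \<and>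
      4 * A' * u1 + (4 * B' - 4) * u2 = \<theta> * u2) \<longleftrightarrow>
    \<theta> = 4 * (N - 4) \<or> \<theta> = 2 * N - 14 \<or> \<theta> = - 4"
proof -
  \<comment> \<open>The determinant of \<open>\<theta>\<close> times the identity minus the
    three-layer matrix.\<close>
  define p where "p = (\<theta> - 4 * B' + 4) * ((\<theta> - (4 - j) * A' - j * B + 4) * (\<theta> - 4 * A + 4) - 4 * j * A * B)
    - 4 * A' * (4 - j) * B' * (\<theta> - 4 * A + 4)"
  have p: "p = (\<theta> - 4 * (N - 4)) * (\<theta> - (2 * N - 14)) * (\<theta> + 4)"
  proof -
    \<comment> \<open>This is the trace minus the two known roots, the valency 4 * (N - 4) and -4;
      \<open>rel\<close> evaluates it to theta_2.\<close>
    have "4 * A + j * B - j * A' - 4 = (3 + 3 * A + (j - 1) * B - j * A') + (N - 10)"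
      unfolding AB by (simp add: algebra_simps)
    hence "4 * A + j * B - j * A' - 4 = 2 * N - 14" using rel by simp
    moreover have "p = (\<theta> - 4 * (N - 4)) * (\<theta> - (4 * A + j * B - j * A' - 4)) * (\<theta> + 4)"
      unfolding p_def AB by (simp add: algebra_simps)
    ultimately show ?thesis by (simp only:)
  qed
  have p0: "p = 0 \<longleftrightarrow> \<theta> = 4 * (N - 4) \<or> \<theta> = 2 * N - 14 \<or> \<theta> = - 4"
    unfolding p by (auto simp: eq_neg_iff_add_eq_0)
  show ?thesis unfolding p0[symmetric]
  proof
    assume "\<exists>u0 u1 u2. (u0 \<noteq> 0 \<or> u1 \<noteq> 0 \<or> u2 \<noteq> 0) \<and>
      (4 * A - 4) * u0 + 4 * B * u1 = \<theta> * u0 \<and>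
      j * A * u0 + ((4 - j) * A' + j * B - 4) * u1 + (4 - j) * B' * u2 = \<theta> * u1 \<and>
      4 * A' * u1 + (4 * B' - 4) * u2 = \<theta> * u2"
    then obtain u0 u1 u2 where u: "u0 \<noteq> 0 \<or> u1 \<noteq> 0 \<or> u2 \<noteq> 0"
      "(4 * A - 4) * u0 + 4 * B * u1 = \<theta> * u0"
      "j * A * u0 + ((4 - j) * A' + j * B - 4) * u1 + (4 - j) * B' * u2 = \<theta> * u1"
      "4 * A' * u1 + (4 * B' - 4) * u2 = \<theta> * u2" by blast
    have "u0 \<noteq> 0"
    proof
      assume u0: "u0 = 0"
      hence u1: "u1 = 0" using u(2) nz by simp
      hence "u2 = 0" using u(3) u0 nz by simp
      thus False using u(1) u0 u1 by simp
    qed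
    moreover have "p * u0 = 0"
    proof -
      define r0 r1 r2 where "r0 = \<theta> * u0 - ((4 * A - 4) * u0 + 4 * B * u1)"
        and "r1 = \<theta> * u1 - (j * A * u0 + ((4 - j) * A' + j * B - 4) * u1 + (4 - j) * B' * u2)"
        and "r2 = \<theta> * u2 - (4 * A' * u1 + (4 * B' - 4) * u2)"
      \<comment> \<open>The coefficients of the residuals r0, r1, r2 are the first row of the
        adjugate.\<close>
      have "p * u0 = ((\<theta> - (4 - j) * A' - j * B + 4) * (\<theta> - 4 * B' + 4) - 4 * A' * (4 - j) * B') * r0
        + 4 * B * (\<theta> - 4 * B' + 4) * r1 + 4 * B * (4 - j) * B' * r2"
        unfolding p_def r0_def r1_def r2_def by (simp add: algebra_simps)
      moreover have "r0 = 0" "r1 = 0" "r2 = 0" using u by (simp_all add: r0_def r1_def r2_def)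
      ultimately show ?thesis by simp
    qed
    ultimately show "p = 0" by simp
  next
    assume p: "p = 0"
    show "\<exists>u0 u1 u2. (u0 \<noteq> 0 \<or> u1 \<noteq> 0 \<or> u2 \<noteq> 0) \<and>
      (4 * A - 4) * u0 + 4 * B * u1 = \<theta> * u0 \<and>
      j * A * u0 + ((4 - j) * A' + j * B - 4) * u1 + (4 - j) * B' * u2 = \<theta> * u1 \<and>
      4 * A' * u1 + (4 * B' - 4) * u2 = \<theta> * u2"
    proof (intro exI conjI)
      \<comment> \<open>The witness is the last column of the adjugate: it satisfies the first two
        equations for every \<open>\<theta>\<close>, and the third amounts to p = 0.\<close>
      show "4 * B * (4 - j) * B' \<noteq> 0 \<or> (\<theta> - 4 * A + 4) * (4 - j) * B' \<noteq> 0 \<or>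
        (\<theta> - (4 - j) * A' - j * B + 4) * (\<theta> - 4 * A + 4) - 4 * j * A * B \<noteq> 0" using nz by simp
      have "\<theta> * ((\<theta> - (4 - j) * A' - j * B + 4) * (\<theta> - 4 * A + 4) - 4 * j * A * B) - (4 * A' * ((\<theta> - 4 * A + 4) * (4 - j) * B') + (4 * B' - 4) *
        ((\<theta> - (4 - j) * A' - j * B + 4) * (\<theta> - 4 * A + 4) - 4 * j * A * B)) = p"
        unfolding p_def by (simp add: algebra_simps)
      thus "4 * A' * ((\<theta> - 4 * A + 4) * (4 - j) * B') + (4 * B' - 4) *
        ((\<theta> - (4 - j) * A' - j * B + 4) * (\<theta> - 4 * A + 4) - 4 * j * A * B) =
        \<theta> * ((\<theta> - (4 - j) * A' - j * B + 4) * (\<theta> - 4 * A + 4) - 4 * j * A * B)"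
        using p by simp
    qed (simp_all add: algebra_simps)
  qed
qed

section \<open>Codes of strength one\<close>

locale strength_one_code = min_eigenvalue_code +
  assumes strength: "code_strength n 4 C = 1"
begin

text \<open>The empty set lies in all codewords, so 0 belongs to the finite set \<open>S\<close>,
  the maximum is attained, and strength 1 can be read off.\<close>

lemma strength_iff:
  defines "S \<equiv> {t. t \<le> 4 \<and> (\<exists>m. \<forall>T. T \<subseteq> V \<and> card T = t \<longrightarrow> card {x \<in> C. T \<subseteq> x} = m)}"
  shows "1 \<in> S" "2 \<notin> S"
proof -
  have S: "code_strength n 4 C = Max S" by (simp add: code_strength_def S_def)
  have fin: "finite S" by (rule finite_subset[of _ "{..4}"]) (auto simp: S_def)
  have "card {x \<in> C. T \<subseteq> x} = card C" if "T \<subseteq> V \<and> card T = 0" for T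
  proof -
    have "T = {}" using that finite_subset[of T V] by auto
    thus ?thesis by simp
  qed
  hence "0 \<in> S" unfolding S_def by blast
  hence "Max S \<in> S" by (intro Max_in[OF fin]) auto
  thus "1 \<in> S" using strength S by simp
  show "2 \<notin> S"
  proof
    assume "2 \<in> S"
    hence "2 \<le> Max S" by (rule Max_ge[OF fin])
    thus False using strength S by simp
  qed
qed

lemma C_eq: "C = {x. x \<subseteq> V \<and> card x = 4 \<and> d x = 0}"
proof -
  have "C \<subseteq> X" using code by (simp add: is_code_def)
  moreover have "x \<in> C \<longleftrightarrow> d x = 0" if "x \<in> X" for x using code_dist_0[OF code that] by simp
  ultimately show ?thesis unfolding X_eq by blast
qed

lemma no_2_design: "\<exists>u\<in>V. \<exists>v\<in>V. u \<noteq> v \<and> card {x. x \<subseteq> V \<and> card x = 4 \<and> d x = 0 \<and> {u, v} \<subseteq> x} \<noteq> m"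
proof -
  have "\<not> (\<forall>T. T \<subseteq> V \<and> card T = 2 \<longrightarrow> card {x \<in> C. T \<subseteq> x} = m)"
    using strength_iff(2) by auto
  then obtain T where T: "T \<subseteq> V" "card T = 2" "card {x \<in> C. T \<subseteq> x} \<noteq> m" by blast
  obtain u v where uv: "T = {u, v}" "u \<noteq> v" using T(2) by (auto simp: card_2_iff)
  have "{x \<in> C. T \<subseteq> x} = {x. x \<subseteq> V \<and> card x = 4 \<and> d x = 0 \<and> {u, v} \<subseteq> x}"
    unfolding uv(1) by (subst C_eq) blast
  hence "card {x. x \<subseteq> V \<and> card x = 4 \<and> d x = 0 \<and> {u, v} \<subseteq> x} \<noteq> m" using T(3) by simp
  moreover have "u \<in> V" "v \<in> V" using T(1) uv(1) by auto
  ultimately show ?thesis using uv(2) by blast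
qed

lemma design: "\<exists>r>0. \<forall>v\<in>V. card {x. x \<subseteq> V \<and> card x = 4 \<and> d x = 0 \<and> v \<in> x} = r"
proof -
  obtain r where r: "\<And>T. T \<subseteq> V \<and> card T = 1 \<Longrightarrow> card {x \<in> C. T \<subseteq> x} = r"
    using strength_iff(1) by auto
  have eq: "card {x. x \<subseteq> V \<and> card x = 4 \<and> d x = 0 \<and> v \<in> x} = r" if "v \<in> V" for v
  proof -
    have "{x \<in> C. {v} \<subseteq> x} = {x. x \<subseteq> V \<and> card x = 4 \<and> d x = 0 \<and> v \<in> x}"
      by (subst C_eq) blast
    thus ?thesis using r[of "{v}"] that by simp
  qed
  obtain c where c: "c \<in> C" using code by (auto simp: is_code_def)
  hence c': "c \<subseteq> V" "card c = 4" "d c = 0" using C_eq by auto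
  have "c \<noteq> {}" using c'(2) by auto
  then obtain v where v: "v \<in> c" by blast
  have "finite {x. x \<subseteq> V \<and> card x = 4 \<and> d x = 0 \<and> v \<in> x}"
    by (rule finite_subset[of _ "Pow V"]) auto
  moreover have "c \<in> {x. x \<subseteq> V \<and> card x = 4 \<and> d x = 0 \<and> v \<in> x}" using c' v by blast
  ultimately have "card {x. x \<subseteq> V \<and> card x = 4 \<and> d x = 0 \<and> v \<in> x} > 0" by (auto simp: card_gt_0_iff)
  hence "0 < r" using eq[of v] c' v by auto
  thus ?thesis using eq by blast
qed

lemma rho_le_3: "\<rho> \<le> 3"
proof -
  obtain x where x: "x \<in> X" "d x = \<rho>" using layer[of \<rho>] by auto
  note x' = johnson_vertsD[OF x(1)]
  have "x \<noteq> {}" using x' by auto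
  then obtain v where v: "v \<in> x" by blast
  obtain r where r: "\<And>v. v \<in> V \<Longrightarrow> card {x. x \<subseteq> V \<and> card x = 4 \<and> d x = 0 \<and> v \<in> x} = r" "0 < r"
    using design by blast
  have "card {x. x \<subseteq> V \<and> card x = 4 \<and> d x = 0 \<and> v \<in> x} > 0" using r(1)[of v] r(2) v x' by auto
  then obtain c where c: "c \<subseteq> V" "card c = 4" "d c = 0" "v \<in> c" by (auto simp: card_gt_0_iff)
  hence "c \<in> C" by (subst C_eq) simp
  hence "d x \<le> card (x - c)" using code_dist_le_card[OF code x(1)] by simp
  also have "card (x - c) < card x" by (rule psubset_card_mono) (use v c x' in auto)
  finally show ?thesis using x x' by simp
qed

lemma layered: obtains r where "layered V d \<tau> a k \<rho> r"
proof -
  obtain r where r: "\<And>v. v \<in> V \<Longrightarrow> card {x. x \<subseteq> V \<and> card x = 4 \<and> d x = 0 \<and> v \<in> x} = r"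
    using design by blast
  have "layered V d \<tau> a k \<rho> r"
  proof
    show "8 \<le> card V" using n by simp
    show "\<exists>x. x \<subseteq> V \<and> card x = 4 \<and> d x = i" if "i \<le> \<rho>" for i
      using layer[OF that] by (auto simp: X_eq)
    show "card {v \<in> x. \<tau> (x - {v}) = d x} = k (d x)" if "x \<subseteq> V" "card x = 4" for x
      using sub_count_eq[of x] that by (simp add: X_eq sub_count_def)
    fix T assume T: "T \<subseteq> V" "card T = 3"
    show "card {v \<in> V - T. d (insert v T) = \<tau> T} = a (\<tau> T)"
      using low_count_eq[OF T] by (simp add: low_count_def)
    show "1 \<le> a (\<tau> T) \<and> a (\<tau> T) + 4 \<le> card V"
      using low_count_bounds[OF T] low_count_eq[OF T] by simp
    show "\<tau> T < \<rho>" by (rule low_count_bounds(3)[OF T])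
  qed (use tau_cases k_bounds r no_2_design in auto)
  thus ?thesis by (rule that)
qed

lemma rho_eq: "\<rho> = 2"
proof -
  obtain r where "layered V d \<tau> a k \<rho> r" by (rule layered)
  then interpret layered V d \<tau> a k \<rho> r .
  show ?thesis using rho_ge_2 rho_ne_3 rho_le_3 by auto
qed

lemma two_class: obtains K where "two_class V (\<lambda>T. \<tau> T = 0) (4 - k 1) (a 0) (n - 3 - a 1) K"
proof -
  obtain r where "layered V d \<tau> a k \<rho> r" by (rule layered)
  then interpret layered V d \<tau> a k \<rho> r .
  show ?thesis using that two_class[OF rho_eq] by simp
qed

abbreviation "H T \<equiv> \<tau> T = 0"

lemma k_1: "1 \<le> k 1" "k 1 \<le> 3" using k_bounds[of 1] rho_eq by auto

lemma tau_01: "T \<subseteq> V \<Longrightarrow> card T = 3 \<Longrightarrow> \<tau> T = 0 \<or> \<tau> T = 1"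
  using low_count_bounds(3)[of T] rho_eq by auto

lemma sub_count_all:
  assumes "x \<in> X" "\<And>v. v \<in> x \<Longrightarrow> \<tau> (x - {v}) = d x"
  shows "k (d x) = 4"
proof -
  have "{v \<in> x. \<tau> (x - {v}) = d x} = x" using assms(2) by auto
  thus ?thesis using sub_count_eq[OF assms(1)] johnson_vertsD[OF assms(1)] by (simp add: sub_count_def)
qed

lemma sub_count_none:
  assumes "x \<in> X" "\<And>v. v \<in> x \<Longrightarrow> \<tau> (x - {v}) \<noteq> d x"
  shows "k (d x) = 0"
proof -
  have e: "{v \<in> x. \<tau> (x - {v}) = d x} = {}" using assms(2) by auto
  show ?thesis using sub_count_eq[OF assms(1)] unfolding sub_count_def e by simp
qed

text \<open>Four 3-subsets of type 0 leave layers 0 and 1, and in layer 1 they would mean k 1 =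
  0.\<close>

lemma layer_0_iff:
  assumes x: "x \<in> X"
  shows "d x = 0 \<longleftrightarrow> (\<forall>v\<in>x. H (x - {v}))"
proof
  assume "d x = 0"
  thus "\<forall>v\<in>x. H (x - {v})" using remove_X(5)[OF x] by auto
next
  assume all: "\<forall>v\<in>x. H (x - {v})"
  have "x \<noteq> {}" using johnson_vertsD[OF x] by auto
  then obtain v where "v \<in> x" by blast
  hence "d x = 0 \<or> d x = 1" using remove_X(5)[OF x, of v] all by auto
  moreover have "d x \<noteq> 1" using sub_count_none[OF x] all k_1 by auto
  ultimately show "d x = 0" by simp
qed

text \<open>Four 3-subsets of type 1 leave layers 1 and 2, and in layer 1 they would mean k 1 =
  4.\<close>

lemma layer_2_iff:
  assumes x: "x \<in> X"
  shows "d x = 2 \<longleftrightarrow> (\<forall>v\<in>x. \<not> H (x - {v}))"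
proof
  assume d: "d x = 2"
  show "\<forall>v\<in>x. \<not> H (x - {v})"
  proof
    fix v assume "v \<in> x"
    thus "\<not> H (x - {v})" using remove_X(5)[OF x, of v] d by auto
  qed
next
  assume all: "\<forall>v\<in>x. \<not> H (x - {v})"
  hence all1: "\<tau> (x - {v}) = 1" if "v \<in> x" for v using tau_01[OF remove_X(1,2)[OF x that]] that by auto
  have "x \<noteq> {}" using johnson_vertsD[OF x] by auto
  then obtain v where "v \<in> x" by blast
  hence "d x = 1 \<or> d x = 2" using remove_X(5)[OF x, of v] all1[of v] by auto
  moreover have "d x \<noteq> 1" using sub_count_all[OF x] all1 k_1 by auto
  ultimately show "d x = 2" by simp
qed

lemma code_eq: "C = {x \<in> X. \<forall>v\<in>x. H (x - {v})}"
  using layer_0_iff by (subst C_eq) (auto simp: X_eq)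

lemma opposite_eq: "opposite_code n 4 C = {x \<in> X. \<forall>v\<in>x. \<not> H (x - {v})}"
  using layer_2_iff unfolding opposite_code_def code_layer_def rho_eq by blast

lemma types: "\<exists>D\<in>{C, opposite_code n 4 C}. type_GP3' n D \<or> type_M1 n D"
proof -
  obtain K where "two_class V (\<lambda>T. H T) (4 - k 1) (a 0) (n - 3 - a 1) K" by (rule two_class)
  then interpret two_class V "\<lambda>T. H T" "4 - k 1" "a 0" "n - 3 - a 1" K .
  interpret c: two_class V "\<lambda>T. \<not> H T" "4 - (4 - k 1)" "n - 3 - a 1" "a 0"
    "(int (card V) - 1) * (int (card V) - 2) - K" by (rule complement)
  \<comment> \<open>The number j is 4 - k 1, so these are j = 1, j = 3 and j = 2; the second becomes
    j = 1 in the complement \<open>c\<close>.\<close>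
  consider "k 1 = 3" | "k 1 = 1" | "k 1 = 2" using k_1 by linarith
  thus ?thesis
  proof cases
    case 1
    hence "4 - k 1 = 1" by simp
    then obtain Y1 Y2 where "Y1 \<union> Y2 = V" "Y1 \<inter> Y2 = {}" "card Y1 = card Y2"
      "\<forall>T. T \<subseteq> V \<longrightarrow> card T = 3 \<longrightarrow> H T \<longleftrightarrow> T \<subseteq> Y1 \<or> T \<subseteq> Y2" by (rule two_cliques)
    hence "type_GP3' n {x \<in> X. \<forall>v\<in>x. H (x - {v})}" by (rule type_GP3'I)
    thus ?thesis unfolding code_eq[symmetric] by blast
  next
    case 2
    hence "4 - (4 - k 1) = 1" by simp
    then obtain Y1 Y2 where "Y1 \<union> Y2 = V" "Y1 \<inter> Y2 = {}" "card Y1 = card Y2"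
      "\<forall>T. T \<subseteq> V \<longrightarrow> card T = 3 \<longrightarrow> \<not> H T \<longleftrightarrow> T \<subseteq> Y1 \<or> T \<subseteq> Y2" by (rule c.two_cliques)
    hence "type_GP3' n (opposite_code n 4 C)" unfolding opposite_eq by (rule type_GP3'I)
    thus ?thesis by blast
  next
    case 3
    hence "4 - k 1 = 2" by simp
    then obtain \<mu> where \<mu>: "\<forall>a\<in>V. \<mu> a \<in> V \<and> \<mu> a \<noteq> a \<and> \<mu> (\<mu> a) = a"
      "(\<forall>T. T \<subseteq> V \<longrightarrow> card T = 3 \<longrightarrow> H T \<longleftrightarrow> (\<exists>a\<in>T. \<mu> a \<in> T)) \<or>
       (\<forall>T. T \<subseteq> V \<longrightarrow> card T = 3 \<longrightarrow> \<not> H T \<longleftrightarrow> (\<exists>a\<in>T. \<mu> a \<in> T))"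
      by (rule perfect_matching)
    from \<mu>(2) show ?thesis
    proof
      assume "\<forall>T. T \<subseteq> V \<longrightarrow> card T = 3 \<longrightarrow> H T \<longleftrightarrow> (\<exists>a\<in>T. \<mu> a \<in> T)"
      hence "type_M1 n {x \<in> X. \<forall>v\<in>x. H (x - {v})}"
        using \<mu>(1) by (intro type_M1I[of n \<mu>]) blast+
      thus ?thesis unfolding code_eq[symmetric] by blast
    next
      assume "\<forall>T. T \<subseteq> V \<longrightarrow> card T = 3 \<longrightarrow> \<not> H T \<longleftrightarrow> (\<exists>a\<in>T. \<mu> a \<in> T)"
      hence "type_M1 n (opposite_code n 4 C)"
        unfolding opposite_eq using \<mu>(1) by (intro type_M1I[of n \<mu>]) blast+
      thus ?thesis by blast
    qed
  qed
qed

lemma spec: "code_spec n 4 C = {johnson_eigenvalue n 4 0, johnson_eigenvalue n 4 2, johnson_eigenvalue n 4 4}"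
proof -
  obtain K where "two_class V (\<lambda>T. H T) (4 - k 1) (a 0) (n - 3 - a 1) K" by (rule two_class)
  then interpret two_class V "\<lambda>T. H T" "4 - k 1" "a 0" "n - 3 - a 1" K .
  obtain x0 x1 x2 where x: "x0 \<in> X" "d x0 = 0" "x1 \<in> X" "d x1 = 1" "x2 \<in> X" "d x2 = 2"
    using layer[of 0] layer[of 1] layer[of 2] rho_eq by auto
  have k0: "k 0 = 4" using sub_count_all[OF x(1)] layer_0_iff[OF x(1)] x(2) by auto
  have k2: "k 2 = 0" using sub_count_none[OF x(5)] tau_01[OF remove_X(1,2)[OF x(5)]] x(6) by fastforce
  have ab: "a 0 + 4 \<le> n" "1 \<le> a 1" "a 1 + 4 \<le> n"
  proof -
    show "a 0 + 4 \<le> n" using a0 by simp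
    have "d x2 = Suc 1" using x(6) by simp
    with x(5) obtain T v w where "T \<subseteq> V" "card T = 3" "\<tau> T = 1" by (rule exists_tau)
    thus "1 \<le> a 1" "a 1 + 4 \<le> n" using low_count_bounds[of T] low_count_eq[of T] by auto
  qed
  define A B A' B' j N :: complex where "A = of_nat (a 0)" and "B = of_nat (n - 3 - a 0)"
    and "A' = of_nat (a 1)" and "B' = of_nat (n - 3 - a 1)" and "j = of_nat (4 - k 1)" and "N = of_nat n"
  have kj: "of_nat (k 1) = 4 - j" using k_1 by (simp add: j_def of_nat_diff)
  have AB: "B = N - 3 - A" "B' = N - 3 - A'"
    using ab by (simp_all add: A_def B_def A'_def B'_def N_def of_nat_diff)
  have nz: "B \<noteq> 0" "B' \<noteq> 0" "4 - j \<noteq> 0"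
    using ab k_1 unfolding B_def B'_def kj[symmetric] by (simp_all del: of_nat_diff)
  \<comment> \<open>The equation \<open>P_eq\<close> over the complex numbers; with b1 = n - 3 - a 1
    the factor N - 3 - b1 in \<open>Q\<close> is \<open>a 1\<close>.\<close>
  have rel: "3 + 3 * A + (j - 1) * B - j * A' = N - 4"
  proof -
    have "of_int P = (of_int (Q + (int (card V) - 4)) :: complex)" using P_eq by simp
    moreover have "of_int P = 3 + 3 * A + (j - 1) * (N - 3 - A)"
      unfolding P_def A_def j_def N_def by simp
    moreover have "of_int Q = j * A'"
      unfolding Q_def A'_def j_def using ab n by (simp add: of_nat_diff)
    ultimately have "3 + 3 * A + (j - 1) * (N - 3 - A) = j * A' + (N - 4)" by (simp add: N_def)
    thus ?thesis unfolding AB by (simp add: algebra_simps)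
  qed
  have L: "of_nat (layer_nbrs n 4 C y i) = of_nat (k (d y) * clique_dist (d y) i + (4 - k (d y)) * clique_dist (d y - 1) i)
      - (if d y = i then 4 else (0 :: complex))" if "y \<in> X" for y i
    using arg_cong[OF layer_nbrs_sub_count[OF that, of i], of "of_nat :: nat \<Rightarrow> complex"] sub_count_eq[OF that]
    by (simp add: algebra_simps split: if_splits)
  have L0: "of_nat (layer_nbrs n 4 C y 0) = 4 * A - 4" "of_nat (layer_nbrs n 4 C y 1) = 4 * B"
    "of_nat (layer_nbrs n 4 C y 2) = (0 :: complex)" if "y \<in> X" "d y = 0" for y
    using L[OF that(1), of 0] L[OF that(1), of 1] L[OF that(1), of 2] that(2) k0
    by (simp_all add: clique_dist_def A_def B_def del: of_nat_diff)
  have L1: "of_nat (layer_nbrs n 4 C y 0) = j * A" "of_nat (layer_nbrs n 4 C y 1) = (4 - j) * A' + j * B - 4"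
    "of_nat (layer_nbrs n 4 C y 2) = (4 - j) * B'" if "y \<in> X" "d y = 1" for y
    unfolding kj[symmetric] using L[OF that(1), of 0] L[OF that(1), of 1] L[OF that(1), of 2] that(2)
    by (simp_all add: clique_dist_def A_def B_def A'_def B'_def j_def del: of_nat_diff)
  have L2: "of_nat (layer_nbrs n 4 C y 0) = (0 :: complex)" "of_nat (layer_nbrs n 4 C y 1) = 4 * A'"
    "of_nat (layer_nbrs n 4 C y 2) = 4 * B' - 4" if "y \<in> X" "d y = 2" for y
    using L[OF that(1), of 0] L[OF that(1), of 1] L[OF that(1), of 2] that(2) k2
    by (simp_all add: clique_dist_def A'_def B'_def del: of_nat_diff)
  have d3: "d y = 0 \<or> d y = 1 \<or> d y = 2" if "y \<in> X" for y using d_le[OF that] rho_eq by auto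
  have "\<theta> \<in> code_spec n 4 C \<longleftrightarrow> \<theta> = 4 * (N - 4) \<or> \<theta> = 2 * N - 14 \<or> \<theta> = - 4" for \<theta>
  proof -
    have s: "(\<Sum>i\<le>\<rho>. of_nat (layer_nbrs n 4 C y i) * u i) = of_nat (layer_nbrs n 4 C y 0) * u 0 +
      of_nat (layer_nbrs n 4 C y 1) * u 1 + of_nat (layer_nbrs n 4 C y 2) * u 2" for y and u :: "nat \<Rightarrow> complex"
      unfolding rho_eq by (simp add: numeral_2_eq_2)
    have "\<theta> \<in> code_spec n 4 C \<longleftrightarrow> (\<exists>u. (u 0 \<noteq> 0 \<or> u 1 \<noteq> 0 \<or> u 2 \<noteq> 0) \<and>
      (4 * A - 4) * u 0 + 4 * B * u 1 = \<theta> * u 0 \<and>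
      j * A * u 0 + ((4 - j) * A' + j * B - 4) * u 1 + (4 - j) * B' * u 2 = \<theta> * u 1 \<and>
      4 * A' * u 1 + (4 * B' - 4) * u (2 :: nat) = \<theta> * u 2)"
      unfolding eigenvalue_iff s
    proof (intro ex_cong1 conj_cong)
      fix u :: "nat \<Rightarrow> complex"
      show "(\<exists>i\<le>\<rho>. u i \<noteq> 0) \<longleftrightarrow> u 0 \<noteq> 0 \<or> u 1 \<noteq> 0 \<or> u 2 \<noteq> 0"
        unfolding rho_eq by (auto simp: le_Suc_eq numeral_2_eq_2)
      show "(\<forall>y\<in>X. of_nat (layer_nbrs n 4 C y 0) * u 0 + of_nat (layer_nbrs n 4 C y 1) * u 1 +
          of_nat (layer_nbrs n 4 C y 2) * u 2 = \<theta> * u (d y)) \<longleftrightarrow>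
        (4 * A - 4) * u 0 + 4 * B * u 1 = \<theta> * u 0 \<and>
        j * A * u 0 + ((4 - j) * A' + j * B - 4) * u 1 + (4 - j) * B' * u 2 = \<theta> * u 1 \<and>
        4 * A' * u 1 + (4 * B' - 4) * u 2 = \<theta> * u 2" (is "?l \<longleftrightarrow> ?r")
      proof
        assume ?l
        from bspec[OF this x(1)] bspec[OF this x(3)] bspec[OF this x(5)] show ?r
          unfolding L0[OF x(1,2)] L1[OF x(3,4)] L2[OF x(5,6)] x(2,4,6) by simp
      next
        assume r: ?r
        show ?l
        proof
          fix y assume y: "y \<in> X"
          from d3[OF y] show "of_nat (layer_nbrs n 4 C y 0) * u 0 + of_nat (layer_nbrs n 4 C y 1) * u 1 +
            of_nat (layer_nbrs n 4 C y 2) * u 2 = \<theta> * u (d y)"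
          proof (elim disjE)
            assume d: "d y = 0"
            show ?thesis using r unfolding L0[OF y d] d by simp
          next
            assume d: "d y = 1"
            show ?thesis using r unfolding L1[OF y d] d by simp
          next
            assume d: "d y = 2"
            show ?thesis using r unfolding L2[OF y d] d by simp
          qed
        qed
      qed
    qed
    also have "\<dots> \<longleftrightarrow> (\<exists>u0 u1 u2. (u0 \<noteq> 0 \<or> u1 \<noteq> 0 \<or> u2 \<noteq> 0) \<and>
      (4 * A - 4) * u0 + 4 * B * u1 = \<theta> * u0 \<and>
      j * A * u0 + ((4 - j) * A' + j * B - 4) * u1 + (4 - j) * B' * u2 = \<theta> * u1 \<and>
      4 * A' * u1 + (4 * B' - 4) * u2 = \<theta> * u2)" (is "(\<exists>u. ?P (u 0) (u 1) (u 2)) \<longleftrightarrow> _")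
    proof
      assume "\<exists>u0 u1 u2. ?P u0 u1 u2"
      then obtain u0 u1 u2 where P: "?P u0 u1 u2" by blast
      define u :: "nat \<Rightarrow> complex" where "u = (\<lambda>i. if i = 0 then u0 else if i = 1 then u1 else u2)"
      have "u 0 = u0" "u 1 = u1" "u 2 = u2" by (auto simp: u_def)
      hence "?P (u 0) (u 1) (u 2)" using P by (simp only:)
      thus "\<exists>u. ?P (u 0) (u 1) (u (2 :: nat))" by blast
    qed blast
    also have "\<dots> \<longleftrightarrow> \<theta> = 4 * (N - 4) \<or> \<theta> = 2 * N - 14 \<or> \<theta> = - 4"
      by (rule tridiagonal_spectrum[OF AB rel nz])
    finally show ?thesis .
  qed
  moreover have "johnson_eigenvalue n 4 0 = 4 * (N - 4)" "johnson_eigenvalue n 4 2 = 2 * N - 14"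
    "johnson_eigenvalue n 4 4 = - 4"
    by (simp_all add: johnson_eigenvalue_def N_def algebra_simps)
  ultimately show ?thesis by auto
qed

end

theorem theorem6:
  fixes n :: nat and C :: "nat set set"
  assumes "2 * 4 \<le> n"
    and "completely_regular n 4 C"
    and "code_strength n 4 C = 1"
    and "johnson_eigenvalue n 4 4 \<in> code_spec n 4 C"
  shows "covering_radius n 4 C = 2 \<and>
    code_spec n 4 C = {johnson_eigenvalue n 4 0, johnson_eigenvalue n 4 2, johnson_eigenvalue n 4 4} \<and>
    (\<exists>D \<in> {C, opposite_code n 4 C}. type_GP3' n D \<or> type_M1 n D)"
proof -
  interpret strength_one_code n C by unfold_locales (use assms in auto)
  show ?thesis using rho_eq spec types by blast
qed

end
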